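(* Let $F:\mathcal X\to\mathcal E$ be Newton-differentiable at $x_\star\in\mathcal X$ with respect to a Newton-derivative $F'\in\Gamma(\mathcal L(T\mathcal X,F^*T\mathcal E))$, where $F(x_\star)=0_{y(x_\star)}$. Assume that for $x\in\mathcal X$ the operator $Q_{F(x)}\circ F'(x):T_x\mathcal X\to E_{y(x)}$ is invertible and that the operator norms of the inverses are uniformly bounded, i.e. there exists $\beta<\infty$ such that $$\big\|(Q_{F(x)}\circ F'(x))^{-1}\big\|_{E_{y(x)}\to T_x\mathcal X}\le\beta .$$ Then Newton's method converges locally to $x_\star$ at a superlinear rate: there is a neighborhood $W$ of $x_\star$ such that for each $x_0\in W$ the Newton iterates $x_k$ converge to $x_\star$, and either $x_k=x_\star$ for some $k$, or $d_{\mathcal X}(x_{k+1},x_\star)/d_{\mathcal X}(x_k,x_\star)\to0$ as $k\to\infty$.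
   Context: **Manifolds and bundles.** $\mathcal X,\mathcal Y$ are $C^1$-Banach manifolds modelled on real Banach spaces $\mathbb X,\mathbb Y$; $\mathcal X$ is connected and Hausdorff. $p:\mathcal E\to\mathcal Y$ is a $C^1$ vector bundle with fibres $E_y=p^{-1}(y)$, zero elements $0_y$, and local trivializations $\tau:p^{-1}(U)\to U\times\mathbb E$, $e\mapsto(p(e),e_\tau)$, $e_\tau=\tau_{p(e)}e$, with $\mathbb E$ a Banach space and $\tau_y\in L(E_y,\mathbb E)$ isomorphisms. An element $\delta e\in T_e\mathcal E$ is represented by $(\delta y,\delta e_\tau)\in T_{p(e)}\mathcal Y\times\mathbb E$ with $\delta y=p'(e)\delta e$. Put $y(x):=p(F(x))$. **Connection map.** $Q$ assigns to every $e\in\mathcal E$ a continuous linear $Q_e:T_e\mathcal E\to E_{p(e)}$ with $Q_e\kappa_e=Id$, where $\kappa_ew=\frac d{dt}(e+tw)|_{t=0}$ for $w\in E_{p(e)}$. In trivializations it has the form $\delta e_\tau-B_{y,\tau}(e_\tau)\delta y$. $Q$ is assumed to be linear ($e_\tau\mapsto B_{y,\tau}(e_\tau)$ is linear) and continuous ($B_{y,\tau}(e_\tau)$, viewed in charts as an element of $L(\mathbb Y,\mathbb E)$, depends continuously on $(y,e_\tau)$). **Newton-differentiability.** A section $F'\in\Gamma(\mathcal L(T\mathcal X,F^*T\mathcal E))$ is a choice of $F'(x)\in L(T_x\mathcal X,T_{F(x)}\mathcal E)$ for every $x$. Let $F$ be locally Lipschitz in charts and $F'$ locally bounded in charts. $F$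 is Newton-differentiable at $x_0$ with respect to $F'$ if for all charts $\phi$ of $\mathcal X$ at $x_0$ and $\psi$ of $\mathcal E$ at $F(x_0)$, with $F_{\psi,\phi}=\psi\circ F\circ\phi^{-1}$, $(F_{\psi,\phi})'(\xi)$ the chart representation of $F'$, and $\xi_0=\phi(x_0)$, $$\lim_{\xi\to\xi_0}\frac{\|(F_{\psi,\phi})'(\xi)(\xi-\xi_0)-(F_{\psi,\phi}(\xi)-F_{\psi,\phi}(\xi_0))\|}{\|\xi-\xi_0\|_{\mathbb X}}=0 .$$ **Retraction.** $R:T\mathcal X\to\mathcal X$ is a $C^1$-retraction: $C^1$ in natural tangent bundle charts, and $R_x:=R|_{T_x\mathcal X}$ satisfies $R_x(0_x)=x$, $R_x'(0_x)=Id_{T_x\mathcal X}$. **Continuous norms and metric.** A function $f$ on the total space of a vector bundle over $\mathcal Z$ is fibrewise uniformly continuous around a subset $D$ of the fibre over $z$ if in any local trivialization $\tau$, with $f_\tau:=f\circ\tau^{-1}$: for all $\varepsilon>0$ there are a neighborhood $U$ of $z$ and $\delta>0$ such that $|f_\tau(z,e)-f_\tau(\hat z,\hat e)|<\varepsilon$ for all $(z,e)\in\tau(D)$, $\hat z\in U$, $\|\hat e-e\|<\delta$. A continuous norm on a vector bundle is a $[0,\infty)$-valued function on the total space restricting on each fibre to a norm equivalent to the model space norm, and which, for each base point, is fibrewise uniformly continuous around the unit sphere of the fibre. $T\mathcal X$ and $\mathcal E$ carry continuous norms $\|\cdot\|_x$ on $T_x\mathcal X$ and $\|\cdot\|_{E_y}$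 on $E_y$. The metric is $d_{\mathcal X}(x,y)=\inf\int_a^b\|\alpha'(t)\|_{\alpha(t)}\,dt$ over piecewise $C^1$-curves $\alpha:[a,b]\to\mathcal X$ from $x$ to $y$. For $A\in L(E_y,T_x\mathcal X)$, $\|A\|_{E_y\to T_x\mathcal X}=\sup_{\|e\|_{E_y}\le1}\|Ae\|_x$. **Newton's method.** Given $x_k$, solve $Q_{F(x_k)}\circ F'(x_k)\,\delta x_k+F(x_k)=0_{y(x_k)}$ for $\delta x_k\in T_{x_k}\mathcal X$ and set $x_{k+1}=R_{x_k}(\delta x_k)$. *)

theory Defs
  imports "HOL-Analysis.Analysis"
begin

section \<open>C1 Banach manifolds\<close>

text \<open>A chart is a pair of its domain and a map whose values off the domain are irrelevant.\<close>

type_synonym ('m, 'a) chart = "'m set \<times> ('m \<Rightarrow> 'a)"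

abbreviation chart_inv :: "('m, 'a) chart \<Rightarrow> 'a \<Rightarrow> 'm" where
  "chart_inv c \<equiv> inv_into (fst c) (snd c)"

definition C1_on :: "('a::real_normed_vector \<Rightarrow> 'b::real_normed_vector) \<Rightarrow> 'a set \<Rightarrow> bool" where
  "C1_on f S \<longleftrightarrow> (\<exists>f' :: 'a \<Rightarrow> 'a \<Rightarrow>\<^sub>L 'b.
     (\<forall>x\<in>S. (f has_derivative blinfun_apply (f' x)) (at x)) \<and> continuous_on S f')"

definition is_chart :: "('m::topological_space, 'a::real_normed_vector) chart \<Rightarrow> bool" where
  "is_chart c \<longleftrightarrow> open (fst c) \<and> open (snd c ` fst c) \<and>
     homeomorphism (fst c) (snd c ` fst c) (snd c) (chart_inv c)"

definition C1_compatible ::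
    "('m, 'a::real_normed_vector) chart \<Rightarrow> ('m, 'a) chart \<Rightarrow> bool" where
  "C1_compatible c d \<longleftrightarrow>
     C1_on (snd d \<circ> chart_inv c) (snd c ` (fst c \<inter> fst d)) \<and>
     C1_on (snd c \<circ> chart_inv d) (snd d ` (fst c \<inter> fst d))"

definition C1_atlas :: "('m::topological_space, 'a::real_normed_vector) chart set \<Rightarrow> bool" where
  "C1_atlas A \<longleftrightarrow> (\<forall>c\<in>A. is_chart c) \<and> (\<forall>c\<in>A. \<forall>d\<in>A. C1_compatible c d) \<and>
     (\<forall>x. \<exists>c\<in>A. x \<in> fst c)"

definition maximal_atlas ::
    "('m::topological_space, 'a::real_normed_vector) chart set \<Rightarrow> ('m, 'a) chart set" where
  "maximal_atlas A = {c. is_chart c \<and> (\<forall>d\<in>A. C1_compatible c d)}"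

text \<open>A manifold is given by its maximal atlas, so that the elements of \<open>A\<close> are all its charts.\<close>

definition C1_manifold :: "('m::topological_space, 'a::real_normed_vector) chart set \<Rightarrow> bool" where
  "C1_manifold A \<longleftrightarrow> C1_atlas A \<and> maximal_atlas A = A"


section \<open>Tangent vectors and curves\<close>

text \<open>A tangent vector at \<open>x\<close> is the family of its representations in the charts at \<open>x\<close>,
  related by the derivatives of the chart changes, and set to \<open>0\<close> on all other pairs.
  The vector space operations are pointwise.\<close>

type_synonym ('m, 'a) tvec = "('m, 'a) chart \<Rightarrow> 'a"

definition tangent_space ::
    "('m, 'a::real_normed_vector) chart set \<Rightarrow> 'm \<Rightarrow> ('m, 'a) tvec set" where
  "tangent_space A x = {v.
     (\<forall>c\<in>A. \<forall>d\<in>A. x \<in> fst c \<longrightarrow> x \<in> fst d \<longrightarrow>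
        v d = frechet_derivative (snd d \<circ> chart_inv c) (at (snd c x)) (v c)) \<and>
     (\<forall>c. c \<notin> A \<or> x \<notin> fst c \<longrightarrow> v c = 0)}"

text \<open>The tangent vector at \<open>x\<close> that is represented by \<open>w\<close> in the chart \<open>c\<close>.\<close>

definition tangent_of ::
    "('m, 'a::real_normed_vector) chart set \<Rightarrow> 'm \<Rightarrow> ('m, 'a) chart \<Rightarrow> 'a \<Rightarrow> ('m, 'a) tvec" where
  "tangent_of A x c w = (\<lambda>d. if d \<in> A \<and> x \<in> fst d
     then frechet_derivative (snd d \<circ> chart_inv c) (at (snd c x)) w else 0)"

definition tangent_bundle ::
    "('m, 'a::real_normed_vector) chart set \<Rightarrow> ('m \<times> ('m, 'a) tvec) set" where
  "tangent_bundle A = {(x, v). v \<in> tangent_space A x}"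

definition velocity ::
    "('m, 'a::real_normed_vector) chart set \<Rightarrow> (real \<Rightarrow> 'm) \<Rightarrow> real \<Rightarrow> ('m, 'a) tvec" where
  "velocity A \<alpha> t = (\<lambda>c. if c \<in> A \<and> \<alpha> t \<in> fst c
     then vector_derivative (snd c \<circ> \<alpha>) (at t) else 0)"

definition C1_curve_on ::
    "('m::topological_space, 'a::real_normed_vector) chart set \<Rightarrow> (real \<Rightarrow> 'm) \<Rightarrow> real \<Rightarrow> real \<Rightarrow> bool"
  where
  "C1_curve_on A \<alpha> s t \<longleftrightarrow> continuous_on {s..t} \<alpha> \<and>
     (\<forall>c\<in>A. \<exists>g. continuous_on ({s..t} \<inter> \<alpha> -` fst c) g \<and>
        (\<forall>u\<in>{s..t} \<inter> \<alpha> -` fst c.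
           ((snd c \<circ> \<alpha>) has_vector_derivative g u) (at u within {s..t})))"

definition piecewise_C1_curve ::
    "('m::topological_space, 'a::real_normed_vector) chart set \<Rightarrow> (real \<Rightarrow> 'm) \<Rightarrow> real \<Rightarrow> real \<Rightarrow> bool"
  where
  "piecewise_C1_curve A \<alpha> a b \<longleftrightarrow> (\<exists>(n::nat) r. r 0 = a \<and> r n = b \<and>
     (\<forall>i<n. r i < r (Suc i) \<and> C1_curve_on A \<alpha> (r i) (r (Suc i))))"

text \<open>At the finitely many break points the velocity is an unspecified value; this does not
  affect the integral. The set of lengths is nonempty when the manifold is connected.\<close>

definition curve_length ::
    "('m, 'a::real_normed_vector) chart set \<Rightarrow> ('m \<times> ('m, 'a) tvec \<Rightarrow> real) \<Rightarrow>
      (real \<Rightarrow> 'm) \<Rightarrow> real \<Rightarrow> real \<Rightarrow> real" where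
  "curve_length A N \<alpha> a b = integral {a..b} (\<lambda>t. N (\<alpha> t, velocity A \<alpha> t))"

definition manifold_dist ::
    "('m::topological_space, 'a::real_normed_vector) chart set \<Rightarrow> ('m \<times> ('m, 'a) tvec \<Rightarrow> real) \<Rightarrow>
      'm \<Rightarrow> 'm \<Rightarrow> real" where
  "manifold_dist A N x y =
     Inf {curve_length A N \<alpha> a b |\<alpha> a b. piecewise_C1_curve A \<alpha> a b \<and> \<alpha> a = x \<and> \<alpha> b = y}"


section \<open>Vector bundles\<close>

text \<open>The pair \<open>(U, \<tau>)\<close> stands for the local trivialization
  \<open>e \<mapsto> (p e, \<tau> e)\<close> of \<open>p -` U\<close> onto \<open>U \<times> UNIV\<close>.\<close>

type_synonym ('y, 'e, 'v) triv = "'y set \<times> ('e \<Rightarrow> 'v)"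

text \<open>The last condition says that the transition maps are linear isomorphisms depending C1 on
  the base point in the operator norm. Hence there is exactly one vector space structure on each
  fibre that makes all trivializations linear; it is the one used below.\<close>

definition C1_vector_bundle ::
    "('y::topological_space, 'b::real_normed_vector) chart set \<Rightarrow>
     ('e::topological_space \<Rightarrow> 'y) \<Rightarrow> ('y, 'e, 'v::real_normed_vector) triv set \<Rightarrow> bool" where
  "C1_vector_bundle AY p TR \<longleftrightarrow> continuous_on UNIV p \<and>
     (\<forall>y. \<exists>s\<in>TR. y \<in> fst s) \<and>
     (\<forall>s\<in>TR. open (fst s) \<and>
        (\<exists>g. homeomorphism (p -` fst s) (fst s \<times> UNIV) (\<lambda>e. (p e, snd s e)) g)) \<and>
     (\<forall>s\<in>TR. \<forall>t\<in>TR. \<forall>c\<in>AY. \<exists>G :: 'b \<Rightarrow> 'v \<Rightarrow>\<^sub>L 'v.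
        C1_on G (snd c ` (fst c \<inter> fst s \<inter> fst t)) \<and>
        (\<forall>e. p e \<in> fst c \<inter> fst s \<inter> fst t \<longrightarrow> snd t e = blinfun_apply (G (snd c (p e))) (snd s e)))"

definition fibre_zero ::
    "('e \<Rightarrow> 'y) \<Rightarrow> ('y, 'e, 'v::real_normed_vector) triv set \<Rightarrow> 'y \<Rightarrow> 'e" where
  "fibre_zero p TR y = (THE e. p e = y \<and> (\<forall>s\<in>TR. y \<in> fst s \<longrightarrow> snd s e = 0))"

text \<open>Addition is meaningful only for two elements of the same fibre.\<close>

definition fibre_add ::
    "('e \<Rightarrow> 'y) \<Rightarrow> ('y, 'e, 'v::real_normed_vector) triv set \<Rightarrow> 'e \<Rightarrow> 'e \<Rightarrow> 'e" where
  "fibre_add p TR e e' = (THE e''. p e'' = p e \<and>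
     (\<forall>s\<in>TR. p e \<in> fst s \<longrightarrow> snd s e'' = snd s e + snd s e'))"

definition fibre_scale ::
    "('e \<Rightarrow> 'y) \<Rightarrow> ('y, 'e, 'v::real_normed_vector) triv set \<Rightarrow> real \<Rightarrow> 'e \<Rightarrow> 'e" where
  "fibre_scale p TR r e = (THE e'. p e' = p e \<and>
     (\<forall>s\<in>TR. p e \<in> fst s \<longrightarrow> snd s e' = r *\<^sub>R snd s e))"

definition bundle_chart ::
    "('e \<Rightarrow> 'y) \<Rightarrow> ('y, 'b) chart \<Rightarrow> ('y, 'e, 'v) triv \<Rightarrow> ('e, 'b \<times> 'v) chart" where
  "bundle_chart p c s = (p -` (fst c \<inter> fst s), \<lambda>e. (snd c (p e), snd s e))"

definition total_atlas ::
    "('y, 'b::real_normed_vector) chart set \<Rightarrow> ('e::topological_space \<Rightarrow> 'y) \<Rightarrow>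
     ('y, 'e, 'v::real_normed_vector) triv set \<Rightarrow> ('e, 'b \<times> 'v) chart set" where
  "total_atlas AY p TR = maximal_atlas {bundle_chart p c s |c s. c \<in> AY \<and> s \<in> TR}"

definition tangent_trivs ::
    "('m, 'a::real_normed_vector) chart set \<Rightarrow> ('m, 'm \<times> ('m, 'a) tvec, 'a) triv set" where
  "tangent_trivs A = {(fst c, \<lambda>(x, v). v c) |c. c \<in> A}"


section \<open>Continuous norms\<close>

text \<open>Here the total space is a subset \<open>T\<close> of its type, which covers both \<open>T = UNIV\<close> for a bundle
  whose total space is a type and \<open>T = tangent_bundle A\<close>. Points of the total space near the fibre
  over \<open>z\<close> are written as such instead of as preimages under the trivialization.\<close>

definition fibrewise_uniformly_continuous_around ::
    "'t set \<Rightarrow> ('t \<Rightarrow> 'z::topological_space) \<Rightarrow> ('z, 't, 'v::real_normed_vector) triv set \<Rightarrow>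
     ('t \<Rightarrow> real) \<Rightarrow> 'z \<Rightarrow> 't set \<Rightarrow> bool" where
  "fibrewise_uniformly_continuous_around T p TR f z D \<longleftrightarrow>
     (\<forall>s\<in>TR. z \<in> fst s \<longrightarrow> (\<forall>\<epsilon>>0. \<exists>U \<delta>. open U \<and> z \<in> U \<and> U \<subseteq> fst s \<and> \<delta> > 0 \<and>
        (\<forall>e\<in>D. \<forall>e'\<in>T. p e' \<in> U \<longrightarrow> norm (snd s e' - snd s e) < \<delta> \<longrightarrow> \<bar>f e - f e'\<bar> < \<epsilon>)))"

definition equivalent_norm :: "('v::real_normed_vector \<Rightarrow> real) \<Rightarrow> bool" where
  "equivalent_norm n \<longleftrightarrow>
     (\<forall>v. n v \<ge> 0) \<and> (\<forall>v. n v = 0 \<longleftrightarrow> v = 0) \<and> (\<forall>r v. n (r *\<^sub>R v) = \<bar>r\<bar> * n v) \<and>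
     (\<forall>v w. n (v + w) \<le> n v + n w) \<and>
     (\<exists>k K. k > 0 \<and> K > 0 \<and> (\<forall>v. k * norm v \<le> n v \<and> n v \<le> K * norm v))"

definition continuous_norm ::
    "'t set \<Rightarrow> ('t \<Rightarrow> 'z::topological_space) \<Rightarrow> ('z, 't, 'v::real_normed_vector) triv set \<Rightarrow>
     ('t \<Rightarrow> real) \<Rightarrow> bool" where
  "continuous_norm T p TR N \<longleftrightarrow>
     (\<forall>s\<in>TR. \<forall>z\<in>fst s. \<exists>n. equivalent_norm n \<and> (\<forall>e\<in>T. p e = z \<longrightarrow> N e = n (snd s e))) \<and>
     (\<forall>z. fibrewise_uniformly_continuous_around T p TR N z {e\<in>T. p e = z \<and> N e = 1})"

text \<open>The operator norm is extended-real-valued, so a real bound on it entails boundedness.\<close>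

definition operator_norm ::
    "'s set \<Rightarrow> ('s \<Rightarrow> real) \<Rightarrow> ('t \<Rightarrow> real) \<Rightarrow> ('s \<Rightarrow> 't) \<Rightarrow> ereal" where
  "operator_norm S N N' L = (SUP e\<in>{e\<in>S. N e \<le> 1}. ereal (N' (L e)))"


section \<open>Connection maps and retractions\<close>

definition vertical_lift ::
    "('y, 'b::real_normed_vector) chart set \<Rightarrow> ('e::topological_space \<Rightarrow> 'y) \<Rightarrow>
     ('y, 'e, 'v::real_normed_vector) triv set \<Rightarrow> 'e \<Rightarrow> 'e \<Rightarrow> ('e, 'b \<times> 'v) tvec" where
  "vertical_lift AY p TR e w =
     velocity (total_atlas AY p TR) (\<lambda>t. fibre_add p TR e (fibre_scale p TR t w)) 0"

definition connection_map ::
    "('y, 'b::real_normed_vector) chart set \<Rightarrow> ('e::topological_space \<Rightarrow> 'y) \<Rightarrow>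
     ('y, 'e, 'v::real_normed_vector) triv set \<Rightarrow> ('e \<Rightarrow> ('e, 'b \<times> 'v) tvec \<Rightarrow> 'e) \<Rightarrow> bool" where
  "connection_map AY p TR Q \<longleftrightarrow>
     (\<forall>e. \<forall>v\<in>tangent_space (total_atlas AY p TR) e. p (Q e v) = p e) \<and>
     (\<forall>e. \<forall>d\<in>total_atlas AY p TR. \<forall>s\<in>TR. e \<in> fst d \<longrightarrow> p e \<in> fst s \<longrightarrow>
        bounded_linear (\<lambda>w. snd s (Q e (tangent_of (total_atlas AY p TR) e d w)))) \<and>
     (\<forall>e w. p w = p e \<longrightarrow> Q e (vertical_lift AY p TR e w) = w)"

text \<open>In the chart \<open>c\<close> of the base and the trivialization \<open>s\<close>, a tangent vector \<open>v\<close> of the total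
  space is represented by the pair \<open>v (bundle_chart p c s)\<close>.\<close>

definition linear_continuous_connection_map ::
    "('y::topological_space, 'b::real_normed_vector) chart set \<Rightarrow>
     ('e::topological_space \<Rightarrow> 'y) \<Rightarrow> ('y, 'e, 'v::real_normed_vector) triv set \<Rightarrow>
     ('e \<Rightarrow> ('e, 'b \<times> 'v) tvec \<Rightarrow> 'e) \<Rightarrow> bool" where
  "linear_continuous_connection_map AY p TR Q \<longleftrightarrow> connection_map AY p TR Q \<and>
     (\<forall>c\<in>AY. \<forall>s\<in>TR. \<exists>B :: 'y \<Rightarrow> 'v \<Rightarrow> 'b \<Rightarrow>\<^sub>L 'v.
        (\<forall>e. p e \<in> fst c \<inter> fst s \<longrightarrow> (\<forall>v\<in>tangent_space (total_atlas AY p TR) e.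
           snd s (Q e v) = snd (v (bundle_chart p c s))
             - blinfun_apply (B (p e) (snd s e)) (fst (v (bundle_chart p c s))))) \<and>
        (\<forall>y\<in>fst c \<inter> fst s. linear (B y)) \<and>
        continuous_on ((fst c \<inter> fst s) \<times> UNIV) (\<lambda>(y, w). B y w))"

text \<open>On a C1 manifold the changes of natural tangent bundle charts are only continuous, so a map
  on the tangent bundle that is C1 in one such chart need not be C1 in another. The second
  condition therefore asks for suitable charts around every point.\<close>

definition C1_retraction ::
    "('m::topological_space, 'a::real_normed_vector) chart set \<Rightarrow>
     ('m \<Rightarrow> ('m, 'a) tvec \<Rightarrow> 'm) \<Rightarrow> bool" where
  "C1_retraction A R \<longleftrightarrow>
     (\<forall>x. R x (\<lambda>_. 0) = x) \<and>
     (\<forall>x. \<forall>v\<in>tangent_space A x. \<exists>c\<in>A. \<exists>d\<in>A. x \<in> fst c \<and> R x v \<in> fst d \<and>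
        (\<exists>S. open S \<and> (snd c x, v c) \<in> S \<and> S \<subseteq> snd c ` fst c \<times> UNIV \<and>
           (\<forall>(\<xi>, w)\<in>S. R (chart_inv c \<xi>) (tangent_of A (chart_inv c \<xi>) c w) \<in> fst d) \<and>
           C1_on (\<lambda>(\<xi>, w). snd d (R (chart_inv c \<xi>) (tangent_of A (chart_inv c \<xi>) c w))) S)) \<and>
     (\<forall>x. \<forall>c\<in>A. x \<in> fst c \<longrightarrow>
        ((\<lambda>w. snd c (R x (tangent_of A x c w))) has_derivative (\<lambda>w. w)) (at 0))"


section \<open>Newton differentiability and Newton's method\<close>

text \<open>The chart representations of a map and of a section of the bundle of continuous linear maps
  from the tangent spaces of the domain to the tangent spaces along the map.\<close>

definition map_rep ::
    "('m, 'a) chart \<Rightarrow> ('n, 'b) chart \<Rightarrow> ('m \<Rightarrow> 'n) \<Rightarrow> 'a \<Rightarrow> 'b" where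
  "map_rep c d F \<xi> = snd d (F (chart_inv c \<xi>))"

definition section_rep ::
    "('m, 'a::real_normed_vector) chart set \<Rightarrow> ('m, 'a) chart \<Rightarrow> ('n, 'b) chart \<Rightarrow>
     ('m \<Rightarrow> ('m, 'a) tvec \<Rightarrow> ('n, 'b) tvec) \<Rightarrow> 'a \<Rightarrow> 'a \<Rightarrow> 'b" where
  "section_rep A c d F' \<xi> w = F' (chart_inv c \<xi>) (tangent_of A (chart_inv c \<xi>) c w) d"

definition hom_section ::
    "('m, 'a::real_normed_vector) chart set \<Rightarrow> ('n, 'b::real_normed_vector) chart set \<Rightarrow>
     ('m \<Rightarrow> 'n) \<Rightarrow> ('m \<Rightarrow> ('m, 'a) tvec \<Rightarrow> ('n, 'b) tvec) \<Rightarrow> bool" where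
  "hom_section A A' F F' \<longleftrightarrow>
     (\<forall>x. F' x ` tangent_space A x \<subseteq> tangent_space A' (F x)) \<and>
     (\<forall>x. \<forall>c\<in>A. \<forall>d\<in>A'. x \<in> fst c \<longrightarrow> F x \<in> fst d \<longrightarrow>
        bounded_linear (section_rep A c d F' (snd c x)))"

definition locally_lipschitz_in_charts ::
    "('m, 'a::real_normed_vector) chart set \<Rightarrow> ('n, 'b::real_normed_vector) chart set \<Rightarrow>
     ('m \<Rightarrow> 'n) \<Rightarrow> bool" where
  "locally_lipschitz_in_charts A A' F \<longleftrightarrow>
     (\<forall>x. \<forall>c\<in>A. \<forall>d\<in>A'. x \<in> fst c \<longrightarrow> F x \<in> fst d \<longrightarrow>
        (\<exists>S L. open S \<and> snd c x \<in> S \<and> S \<subseteq> snd c ` (fst c \<inter> F -` fst d) \<and>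
           L-lipschitz_on S (map_rep c d F)))"

definition locally_bounded_in_charts ::
    "('m, 'a::real_normed_vector) chart set \<Rightarrow> ('n, 'b::real_normed_vector) chart set \<Rightarrow>
     ('m \<Rightarrow> 'n) \<Rightarrow> ('m \<Rightarrow> ('m, 'a) tvec \<Rightarrow> ('n, 'b) tvec) \<Rightarrow> bool" where
  "locally_bounded_in_charts A A' F F' \<longleftrightarrow>
     (\<forall>x. \<forall>c\<in>A. \<forall>d\<in>A'. x \<in> fst c \<longrightarrow> F x \<in> fst d \<longrightarrow>
        (\<exists>S K. open S \<and> snd c x \<in> S \<and> S \<subseteq> snd c ` (fst c \<inter> F -` fst d) \<and>
           (\<forall>\<xi>\<in>S. onorm (section_rep A c d F' \<xi>) \<le> K)))"

definition newton_differentiable_at ::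
    "('m, 'a::real_normed_vector) chart set \<Rightarrow> ('n, 'b::real_normed_vector) chart set \<Rightarrow>
     ('m \<Rightarrow> 'n) \<Rightarrow> ('m \<Rightarrow> ('m, 'a) tvec \<Rightarrow> ('n, 'b) tvec) \<Rightarrow> 'm \<Rightarrow> bool" where
  "newton_differentiable_at A A' F F' x\<^sub>0 \<longleftrightarrow>
     (\<forall>c\<in>A. \<forall>d\<in>A'. x\<^sub>0 \<in> fst c \<longrightarrow> F x\<^sub>0 \<in> fst d \<longrightarrow>
        ((\<lambda>\<xi>. norm (section_rep A c d F' \<xi> (\<xi> - snd c x\<^sub>0)
                 - (map_rep c d F \<xi> - map_rep c d F (snd c x\<^sub>0))) / norm (\<xi> - snd c x\<^sub>0))
          \<longlongrightarrow> 0) (at (snd c x\<^sub>0)))"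

definition newton_sequence ::
    "('m, 'a::real_normed_vector) chart set \<Rightarrow> ('e \<Rightarrow> 'y) \<Rightarrow>
     ('y, 'e, 'v::real_normed_vector) triv set \<Rightarrow> ('e \<Rightarrow> ('e, 'b \<times> 'v) tvec \<Rightarrow> 'e) \<Rightarrow>
     ('m \<Rightarrow> ('m, 'a) tvec \<Rightarrow> 'm) \<Rightarrow> ('m \<Rightarrow> 'e) \<Rightarrow>
     ('m \<Rightarrow> ('m, 'a) tvec \<Rightarrow> ('e, 'b \<times> 'v) tvec) \<Rightarrow> (nat \<Rightarrow> 'm) \<Rightarrow> bool" where
  "newton_sequence A p TR Q R F F' x \<longleftrightarrow>
     (\<forall>k. \<exists>\<delta>\<in>tangent_space A (x k).
        fibre_add p TR (Q (F (x k)) (F' (x k) \<delta>)) (F (x k)) = fibre_zero p TR (p (F (x k))) \<and>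
        x (Suc k) = R (x k) \<delta>)"

end

theory Submission
  imports Defs
begin

text \<open>In the chart \<open>c\<close> at the zero \<open>z\<close> that the retraction provides, write \<open>h\<close> for the error of an
  iterate \<open>x\<close> and \<open>w\<close> for its Newton step. In a trivialization the operator of the Newton equation is
  the fibre part of \<open>F' x\<close> minus a term that is linear in the fibre part of \<open>F x\<close>; this term tends to
  0 as \<open>x\<close> tends to \<open>z\<close>, because \<open>F\<close> vanishes at \<open>z\<close>. Newton differentiability therefore makes the
  operator map \<open>w + h\<close> to an element of size \<open>o(h)\<close>, and the bound on the inverses gives
  \<open>w + h = o(h)\<close>. The retraction maps \<open>(x, w)\<close> to a point with error \<open>h + w + o(h) = o(h)\<close>, so that the
  convergence is superlinear in the chart. Near \<open>z\<close> the metric of the manifold is equivalent to the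
  norm in the chart.\<close>

section \<open>Charts and tangent vectors\<close>

text \<open>The bound \<beta> refers to norms that vary with the fibre. It reaches the chart because
  a continuous norm is, near a point, equivalent to the model norm with constants common to all
  nearby fibres; no bundle is assumed to be trivial, so this comparison is made inside one
  trivialization. The chart at \<open>z\<close> cannot be chosen freely: a retraction is C1 only in
  suitable tangent bundle charts. The estimate for the Newton step is therefore proved in every
  chart at \<open>z\<close>, and the chart of the retraction is inserted at the end. In the total
  space, on the other hand, a product chart is forced, since only there does \<open>Q\<close> have
  its explicit form. The passage to the metric costs a factor \<open>M / m\<close>, which is
  harmless because the contraction factor in the chart can be made arbitrarily small. The lower
  bound is the delicate half of the norm comparison: the competing curves may leave the chart.
  Convergence in the topology is read off in the chart and does not pass through the metric.\<close>

lemma chart_inv_chart [simp]: "is_chart c \<Longrightarrow> x \<in> fst c \<Longrightarrow> chart_inv c (snd c x) = x"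
  unfolding is_chart_def by (auto dest: homeomorphism_apply1)

lemma chart_eqD:
  assumes "is_chart c" "x \<in> fst c" "y \<in> fst c" "snd c x = snd c y"
  shows "x = y"
proof -
  have "chart_inv c (snd c x) = chart_inv c (snd c y)" by (simp only: assms(4))
  then show ?thesis by (simp only: chart_inv_chart[OF assms(1,2)] chart_inv_chart[OF assms(1,3)])
qed

lemma chart_chart_inv: "\<xi> \<in> snd c ` fst c \<Longrightarrow> snd c (chart_inv c \<xi>) = \<xi>"
  by (rule f_inv_into_f)

lemma chart_inv_into: "\<xi> \<in> snd c ` fst c \<Longrightarrow> chart_inv c \<xi> \<in> fst c"
  by (rule inv_into_into)

lemma is_chart_continuous: "is_chart c \<Longrightarrow> continuous_on (fst c) (snd c)"
  and is_chart_inv_continuous: "is_chart c \<Longrightarrow> continuous_on (snd c ` fst c) (chart_inv c)"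
  unfolding is_chart_def homeomorphism_def by auto

lemma is_chart_open: "is_chart c \<Longrightarrow> open (fst c)" "is_chart c \<Longrightarrow> open (snd c ` fst c)"
  unfolding is_chart_def by auto

lemma is_chart_vimage_open:
  assumes "is_chart c" "open V"
  shows "open (fst c \<inter> snd c -` V)"
  using assms continuous_open_preimage is_chart_continuous is_chart_open by blast

lemma is_chart_image_open:
  assumes c: "is_chart c" and "open U"
  shows "open (snd c ` (fst c \<inter> U))"
proof -
  have "snd c ` (fst c \<inter> U) = snd c ` fst c \<inter> chart_inv c -` U"
  proof (intro set_eqI iffI)
    fix \<xi> assume "\<xi> \<in> snd c ` (fst c \<inter> U)"
    then show "\<xi> \<in> snd c ` fst c \<inter> chart_inv c -` U" using c by auto
  next
    fix \<xi> assume "\<xi> \<in> snd c ` fst c \<inter> chart_inv c -` U"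
    then show "\<xi> \<in> snd c ` (fst c \<inter> U)"
      using chart_chart_inv[of \<xi> c] chart_inv_into[of \<xi> c]
      by (intro image_eqI[of _ _ "chart_inv c \<xi>"]) auto
  qed
  then show ?thesis
    using continuous_open_preimage[OF is_chart_inv_continuous[OF c] is_chart_open(2)[OF c] assms(2)]
    by simp
qed

section \<open>Derivatives of chart changes, and tangent vectors given by one representative\<close>

abbreviation change_deriv ::
    "('m, 'a::real_normed_vector) chart \<Rightarrow> ('m, 'a) chart \<Rightarrow> 'm \<Rightarrow> 'a \<Rightarrow> 'a" where
  "change_deriv c d x \<equiv> frechet_derivative (snd d \<circ> chart_inv c) (at (snd c x))"

lemma change_has_derivative:
  assumes "C1_atlas A" "c \<in> A" "d \<in> A" "x \<in> fst c" "x \<in> fst d"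
  shows "((snd d \<circ> chart_inv c) has_derivative change_deriv c d x) (at (snd c x))"
proof -
  have "C1_on (snd d \<circ> chart_inv c) (snd c ` (fst c \<inter> fst d))"
    using assms(1-3) by (simp add: C1_atlas_def C1_compatible_def)
  then obtain f' where f': "\<forall>\<xi>\<in>snd c ` (fst c \<inter> fst d).
      ((snd d \<circ> chart_inv c) has_derivative blinfun_apply (f' \<xi>)) (at \<xi>)"
    unfolding C1_on_def by (elim exE conjE)
  have "snd c x \<in> snd c ` (fst c \<inter> fst d)" using assms(4,5) by simp
  from bspec[OF f' this] have "(snd d \<circ> chart_inv c) differentiable (at (snd c x))"
    by (rule differentiableI)
  then show ?thesis by (rule frechet_derivative_works[THEN iffD1])
qed

lemma change_deriv_bounded_linear:
  assumes "C1_atlas A" "c \<in> A" "d \<in> A" "x \<in> fst c" "x \<in> fst d"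
  shows "bounded_linear (change_deriv c d x)"
  by (rule has_derivative_bounded_linear[OF change_has_derivative[OF assms]])

lemma C1_atlas_is_chart: "C1_atlas A \<Longrightarrow> c \<in> A \<Longrightarrow> is_chart c"
  unfolding C1_atlas_def by auto

lemma change_deriv_self:
  assumes "C1_atlas A" "c \<in> A" "x \<in> fst c"
  shows "change_deriv c c x w = w"
proof -
  have "is_chart c" using assms C1_atlas_is_chart by blast
  then have "((snd c \<circ> chart_inv c) has_derivative (\<lambda>w. w)) (at (snd c x))"
    using assms(3)
    by (intro has_derivative_transform_within_open[OF has_derivative_ident, of "snd c ` fst c"])
       (auto simp: is_chart_open)
  from frechet_derivative_at[OF this] show ?thesis by metis
qed

text \<open>Chain rule and uniqueness of the derivative: on the image of the overlap of
  \<open>c\<close> and \<open>d\<close>, the change to \<open>e\<close> through \<open>d\<close>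
  coincides with the direct one. This identity is what makes the family
  \<open>tangent_of A x c w\<close> a tangent vector.\<close>

lemma change_deriv_cocycle:
  assumes A: "C1_atlas A" and mem: "c \<in> A" "d \<in> A" "e \<in> A" "x \<in> fst c" "x \<in> fst d" "x \<in> fst e"
  shows "change_deriv d e x (change_deriv c d x w) = change_deriv c e x w"
proof -
  have c: "is_chart c" and d: "is_chart d" using A mem C1_atlas_is_chart by blast+
  have "(snd d \<circ> chart_inv c) (snd c x) = snd d x" using c mem by simp
  then have "((snd e \<circ> chart_inv d) has_derivative change_deriv d e x)
      (at ((snd d \<circ> chart_inv c) (snd c x)))"
    using change_has_derivative[OF A mem(2,3,5,6)] by (simp only:)
  from diff_chain_at[OF change_has_derivative[OF A mem(1,2,4,5)] this]
  have "((snd e \<circ> chart_inv c) has_derivative change_deriv d e x \<circ> change_deriv c d x)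
      (at (snd c x))"
  proof (rule has_derivative_transform_within_open[where s = "snd c ` (fst c \<inter> fst d)"])
    show "open (snd c ` (fst c \<inter> fst d))"
      using c d by (simp add: is_chart_image_open is_chart_open)
  qed (use mem c d in auto)
  then have "change_deriv d e x \<circ> change_deriv c d x = change_deriv c e x"
    by (rule frechet_derivative_at)
  then show ?thesis by (metis o_apply)
qed

lemma tangent_of_self:
  assumes "C1_atlas A" "c \<in> A" "x \<in> fst c"
  shows "tangent_of A x c w c = w"
  using assms change_deriv_self[OF assms] by (simp add: tangent_of_def)

lemma tangent_of_in_tangent_space:
  assumes "C1_atlas A" "c \<in> A" "x \<in> fst c"
  shows "tangent_of A x c w \<in> tangent_space A x"
  using assms change_deriv_cocycle[OF assms(1)] by (auto simp: tangent_space_def tangent_of_def)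

text \<open>One representative determines the whole family, so statements about tangent vectors at
  \<open>x\<close> reduce to vectors of the model space in a fixed chart.\<close>

lemma tangent_space_eq_tangent_of:
  assumes "C1_atlas A" "c \<in> A" "x \<in> fst c" "v \<in> tangent_space A x"
  shows "v = tangent_of A x c (v c)"
proof
  fix d
  have "\<forall>c\<in>A. \<forall>d\<in>A. x \<in> fst c \<longrightarrow> x \<in> fst d \<longrightarrow> v d = change_deriv c d x (v c)"
    and off: "\<forall>c. c \<notin> A \<or> x \<notin> fst c \<longrightarrow> v c = 0"
    using assms(4) unfolding tangent_space_def mem_Collect_eq by (rule conjunct1, rule conjunct2)
  from bspec[OF this(1) assms(2)] assms(3)
  have on: "\<forall>d\<in>A. x \<in> fst d \<longrightarrow> v d = change_deriv c d x (v c)" by blast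
  show "v d = tangent_of A x c (v c) d"
  proof (cases "d \<in> A \<and> x \<in> fst d")
    case True
    then have "v d = change_deriv c d x (v c)" using on by blast
    then show ?thesis using True by (simp only: tangent_of_def if_True simp_thms)
  next
    case False
    then have "v d = 0" using off by blast
    then show ?thesis using False by (simp only: tangent_of_def if_False simp_thms)
  qed
qed

lemma tangent_of_zero:
  assumes "C1_atlas A" "c \<in> A" "x \<in> fst c"
  shows "tangent_of A x c 0 = (\<lambda>_. 0)"
proof
  fix d
  show "tangent_of A x c 0 d = 0"
  proof (cases "d \<in> A \<and> x \<in> fst d")
    case True
    then have "bounded_linear (change_deriv c d x)"
      using change_deriv_bounded_linear assms by blast
    then show ?thesis using True by (simp add: tangent_of_def linear_simps)
  qed (auto simp: tangent_of_def)
qed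

lemma zero_in_tangent_space:
  assumes "C1_atlas A"
  shows "(\<lambda>_. 0) \<in> tangent_space A x"
proof -
  obtain c where c: "c \<in> A" "x \<in> fst c" using assms unfolding C1_atlas_def by blast
  show ?thesis
    using tangent_of_in_tangent_space[OF assms c, of 0] tangent_of_zero[OF assms c] by simp
qed

section \<open>Continuous norms\<close>

lemma equivalent_norm_zero: "equivalent_norm n \<Longrightarrow> n 0 = 0"
  and equivalent_norm_pos: "equivalent_norm n \<Longrightarrow> v \<noteq> 0 \<Longrightarrow> n v > 0"
  and equivalent_norm_scaleR: "equivalent_norm n \<Longrightarrow> n (r *\<^sub>R v) = \<bar>r\<bar> * n v"
  unfolding equivalent_norm_def by (auto simp: less_le)

lemma fibrewise_uniformly_continuous_aroundD:
  assumes "fibrewise_uniformly_continuous_around T p TR f z D" "s \<in> TR" "z \<in> fst s" "\<epsilon> > 0"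
  obtains U \<delta> where "open U" "z \<in> U" "U \<subseteq> fst s" "\<delta> > 0"
    "\<And>e e'. e \<in> D \<Longrightarrow> e' \<in> T \<Longrightarrow> p e' \<in> U \<Longrightarrow> norm (snd s e' - snd s e) < \<delta> \<Longrightarrow> \<bar>f e - f e'\<bar> < \<epsilon>"
proof -
  have "\<exists>U \<delta>. open U \<and> z \<in> U \<and> U \<subseteq> fst s \<and> \<delta> > 0 \<and>
      (\<forall>e\<in>D. \<forall>e'\<in>T. p e' \<in> U \<longrightarrow> norm (snd s e' - snd s e) < \<delta> \<longrightarrow> \<bar>f e - f e'\<bar> < \<epsilon>)"
    using assms unfolding fibrewise_uniformly_continuous_around_def by simp
  then show ?thesis using that by (elim exE conjE) simp
qed

text \<open>Elements of a nearby fibre are compared with the elements over \<open>z\<close> that have the same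
  representative, which exist by the surjectivity premise.\<close>

lemma continuous_norm_locally_equivalent:
  assumes N: "continuous_norm T p TR N" and s: "s \<in> TR" "z \<in> fst s"
    and onto: "\<And>y w. y \<in> fst s \<Longrightarrow> \<exists>e\<in>T. p e = y \<and> snd s e = w"
  obtains U m M where "open U" "z \<in> U" "U \<subseteq> fst s" "m > 0" "M > 0"
    "\<And>e. e \<in> T \<Longrightarrow> p e \<in> U \<Longrightarrow> m * norm (snd s e) \<le> N e"
    "\<And>e. e \<in> T \<Longrightarrow> p e \<in> U \<Longrightarrow> N e \<le> M * norm (snd s e)"
proof -
  have fibre: "\<exists>n. equivalent_norm n \<and> (\<forall>e\<in>T. p e = y \<longrightarrow> N e = n (snd s e))"
    if "y \<in> fst s" for y
    using N s that unfolding continuous_norm_def by blast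
  obtain n where n: "equivalent_norm n" "\<And>e. e \<in> T \<Longrightarrow> p e = z \<Longrightarrow> N e = n (snd s e)"
    using fibre[OF s(2)] by blast
  obtain k K where k: "k > 0" "K > 0" "\<And>v. k * norm v \<le> n v" "\<And>v. n v \<le> K * norm v"
    using n(1) unfolding equivalent_norm_def by blast
  have unif: "fibrewise_uniformly_continuous_around T p TR N z {e\<in>T. p e = z \<and> N e = 1}"
    using N unfolding continuous_norm_def by blast
  obtain U \<delta> where U: "open U" "z \<in> U" "U \<subseteq> fst s" and \<delta>: "\<delta> > 0" and
    close: "\<And>e e'. e \<in> {e\<in>T. p e = z \<and> N e = 1} \<Longrightarrow> e' \<in> T \<Longrightarrow> p e' \<in> U \<Longrightarrow>
       norm (snd s e' - snd s e) < \<delta> \<Longrightarrow> \<bar>N e - N e'\<bar> < 1/2"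
    by (rule fibrewise_uniformly_continuous_aroundD[OF unif s, of "1/2"]) simp_all
  \<comment> \<open>On the unit sphere over \<open>z\<close> the norm is 1, so the tolerance 1/2
    keeps it between 1/2 and 3/2 on nearby fibres; homogeneity then compares the two norms of any
    representative up to the factor 2.\<close>
  have bounds: "n (snd s e) / 2 \<le> N e \<and> N e \<le> 2 * n (snd s e)" if e: "e \<in> T" "p e \<in> U" for e
  proof -
    obtain n' where n': "equivalent_norm n'" "\<And>e'. e' \<in> T \<Longrightarrow> p e' = p e \<Longrightarrow> N e' = n' (snd s e')"
      using fibre[of "p e"] U e by blast
    show ?thesis
    proof (cases "snd s e = 0")
      case True
      then show ?thesis using n' n(1) e by (simp add: equivalent_norm_zero)
    next
      case False
      define \<nu> where "\<nu> = n (snd s e)"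
      have \<nu>: "\<nu> > 0" using n(1) False by (simp add: \<nu>_def equivalent_norm_pos)
      \<comment> \<open>Normalising by the norm over \<open>z\<close> puts \<open>e0\<close> on the
        unit sphere. Since \<open>e1\<close> has the same representative over \<open>p e\<close>,
        the condition on \<delta> holds with distance 0.\<close>
      define w where "w = (1 / \<nu>) *\<^sub>R snd s e"
      obtain e0 where e0: "e0 \<in> T" "p e0 = z" "snd s e0 = w" using onto s(2) by blast
      obtain e1 where e1: "e1 \<in> T" "p e1 = p e" "snd s e1 = w"
        using onto[of "p e"] U(3) e by blast
      have "N e0 = 1"
        using n e0 \<nu> by (simp add: w_def \<nu>_def equivalent_norm_scaleR)
      then have "\<bar>1 - N e1\<bar> < 1/2"
        using close[of e0 e1] e0 e1 e \<delta> by simp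
      moreover have "N e1 = N e / \<nu>"
        using n' e1 e \<nu> by (simp add: w_def equivalent_norm_scaleR)
      ultimately have "1/2 \<le> N e / \<nu>" "N e / \<nu> \<le> 2" by linarith+
      then show ?thesis using \<nu> unfolding \<nu>_def by (simp add: field_simps)
    qed
  qed
  show ?thesis
  proof (rule that[of U "k/2" "2*K"])
    fix e assume "e \<in> T" "p e \<in> U"
    with bounds[of e] k(3)[of "snd s e"] k(4)[of "snd s e"]
    show "k/2 * norm (snd s e) \<le> N e" "N e \<le> 2 * K * norm (snd s e)" by auto
  qed (use U k in auto)
qed

text \<open>The definition asks for continuity only around the unit sphere; homogeneity extends it to all
  nonzero elements, and the local equivalence of norms to the zero element.\<close>

lemma continuous_norm_continuous:
  assumes N: "continuous_norm T p TR N" and s: "s \<in> TR" "z \<in> fst s"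
    and onto: "\<And>y w. y \<in> fst s \<Longrightarrow> \<exists>e\<in>T. p e = y \<and> snd s e = w"
    and e0: "e0 \<in> T" "p e0 = z" and \<epsilon>: "\<epsilon> > 0"
  obtains U \<delta> where "open U" "z \<in> U" "U \<subseteq> fst s" "\<delta> > 0"
    "\<And>e. e \<in> T \<Longrightarrow> p e \<in> U \<Longrightarrow> norm (snd s e - snd s e0) < \<delta> \<Longrightarrow> \<bar>N e0 - N e\<bar> < \<epsilon>"
proof -
  have fibre: "\<exists>n. equivalent_norm n \<and> (\<forall>e\<in>T. p e = y \<longrightarrow> N e = n (snd s e))"
    if "y \<in> fst s" for y
    using N s that unfolding continuous_norm_def by blast
  obtain n where n: "equivalent_norm n" "\<And>e. e \<in> T \<Longrightarrow> p e = z \<Longrightarrow> N e = n (snd s e)"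
    using fibre[OF s(2)] by blast
  show ?thesis
  proof (cases "snd s e0 = 0")
    case True
    then have N0: "N e0 = 0" using n e0 by (simp add: equivalent_norm_zero)
    obtain U m M where U: "open U" "z \<in> U" "U \<subseteq> fst s" and m: "m > 0" "M > 0"
      "\<And>e. e \<in> T \<Longrightarrow> p e \<in> U \<Longrightarrow> m * norm (snd s e) \<le> N e"
      "\<And>e. e \<in> T \<Longrightarrow> p e \<in> U \<Longrightarrow> N e \<le> M * norm (snd s e)"
      using continuous_norm_locally_equivalent[OF N s onto] by blast
    show ?thesis
    proof (rule that[of U "\<epsilon> / M"])
      fix e assume e: "e \<in> T" "p e \<in> U" "norm (snd s e - snd s e0) < \<epsilon> / M"
      then have "M * norm (snd s e) < \<epsilon>" using True m by (simp add: field_simps)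
      moreover have "0 \<le> m * norm (snd s e)" using m(1) by simp
      ultimately show "\<bar>N e0 - N e\<bar> < \<epsilon>" using m(3,4)[of e] e N0 by linarith
    qed (use U m \<epsilon> in auto)
  next
    case False
    define \<nu> where "\<nu> = N e0"
    have \<nu>: "\<nu> > 0" using n e0 False by (simp add: \<nu>_def equivalent_norm_pos)
    obtain e1 where e1: "e1 \<in> T" "p e1 = z" "snd s e1 = (1 / \<nu>) *\<^sub>R snd s e0"
      using onto s(2) by blast
    have N1: "N e1 = 1"
      using n e0 e1 \<nu> by (simp add: \<nu>_def equivalent_norm_scaleR)
    have unif: "fibrewise_uniformly_continuous_around T p TR N z {e\<in>T. p e = z \<and> N e = 1}"
      using N unfolding continuous_norm_def by blast
    have \<epsilon>\<nu>: "\<epsilon> / \<nu> > 0" using \<nu> \<epsilon> by simp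
    obtain U \<delta> where U: "open U" "z \<in> U" "U \<subseteq> fst s" and \<delta>: "\<delta> > 0" and
      close: "\<And>e e'. e \<in> {e\<in>T. p e = z \<and> N e = 1} \<Longrightarrow> e' \<in> T \<Longrightarrow> p e' \<in> U \<Longrightarrow>
         norm (snd s e' - snd s e) < \<delta> \<Longrightarrow> \<bar>N e - N e'\<bar> < \<epsilon> / \<nu>"
      by (rule fibrewise_uniformly_continuous_aroundD[OF unif s \<epsilon>\<nu>]) simp_all
    \<comment> \<open>Division by \<nu> carries \<open>e0\<close> to the unit sphere and divides
      distances and norms by \<nu>, so the radius \<open>\<nu> * \<delta>\<close> and the error
      \<epsilon> at \<open>e0\<close> correspond to \<delta> and \<open>\<epsilon> / \<nu>\<close>
      on the sphere.\<close>
    show ?thesis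
    proof (rule that[of U "\<nu> * \<delta>"])
      fix e assume e: "e \<in> T" "p e \<in> U" "norm (snd s e - snd s e0) < \<nu> * \<delta>"
      obtain n' where n': "equivalent_norm n'"
        "\<And>e'. e' \<in> T \<Longrightarrow> p e' = p e \<Longrightarrow> N e' = n' (snd s e')"
        using fibre[of "p e"] U e by blast
      obtain e2 where e2: "e2 \<in> T" "p e2 = p e" "snd s e2 = (1 / \<nu>) *\<^sub>R snd s e"
        using onto[of "p e"] U(3) e by blast
      have N2: "N e2 = N e / \<nu>"
        using n' e2 e \<nu> by (simp add: equivalent_norm_scaleR)
      have "snd s e2 - snd s e1 = (1 / \<nu>) *\<^sub>R (snd s e - snd s e0)"
        using e1 e2 by (simp add: scaleR_right_diff_distrib)
      then have "norm (snd s e2 - snd s e1) = norm (snd s e - snd s e0) / \<nu>"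
        using \<nu> by simp
      also have "\<dots> < \<delta>" using e(3) \<nu> by (simp add: pos_divide_less_eq mult.commute)
      finally have "norm (snd s e2 - snd s e1) < \<delta>" .
      then have "\<bar>1 - N e / \<nu>\<bar> < \<epsilon> / \<nu>"
        using close[of e1 e2] e1 e2 e N1 N2 by simp
      moreover have "1 - N e / \<nu> = (\<nu> - N e) / \<nu>" using \<nu> by (simp add: field_simps)
      ultimately have "\<bar>\<nu> - N e\<bar> / \<nu> < \<epsilon> / \<nu>" using \<nu> by simp
      then show "\<bar>N e0 - N e\<bar> < \<epsilon>"
        using \<nu> unfolding \<nu>_def by (simp add: divide_less_cancel)
    qed (use U \<nu> \<delta> in auto)
  qed
qed

section \<open>Continuous norms on the tangent bundle\<close>

lemma tangent_triv_onto:
  assumes "C1_atlas A" "c \<in> A" "y \<in> fst (fst c, \<lambda>(x, v). v c)"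
  shows "\<exists>e\<in>tangent_bundle A. fst e = y \<and> snd (fst c, \<lambda>(x, v). v c) e = w"
  using assms tangent_of_in_tangent_space[OF assms(1,2)] tangent_of_self[OF assms(1,2)]
  by (intro bexI[of _ "(y, tangent_of A y c w)"]) (simp_all add: tangent_bundle_def)

lemma tangent_trivs_member: "c \<in> A \<Longrightarrow> (fst c, \<lambda>(x, v). v c) \<in> tangent_trivs A"
  unfolding tangent_trivs_def by blast

lemma tangent_norm_locally_equivalent:
  assumes A: "C1_atlas A" and N: "continuous_norm (tangent_bundle A) fst (tangent_trivs A) N"
    and c: "c \<in> A" "z \<in> fst c"
  obtains U m M where "open U" "z \<in> U" "U \<subseteq> fst c" "m > 0" "M > 0"
    "\<And>x v. x \<in> U \<Longrightarrow> v \<in> tangent_space A x \<Longrightarrow> m * norm (v c) \<le> N (x, v)"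
    "\<And>x v. x \<in> U \<Longrightarrow> v \<in> tangent_space A x \<Longrightarrow> N (x, v) \<le> M * norm (v c)"
proof (rule continuous_norm_locally_equivalent[OF N tangent_trivs_member[OF c(1)], of z])
  fix U m M
  assume "open U" "z \<in> U" "U \<subseteq> fst (fst c, \<lambda>(x, v). v c)" "m > 0" "M > 0"
    and *: "\<And>e. e \<in> tangent_bundle A \<Longrightarrow> fst e \<in> U \<Longrightarrow> m * norm (snd (fst c, \<lambda>(x, v). v c) e) \<le> N e"
    "\<And>e. e \<in> tangent_bundle A \<Longrightarrow> fst e \<in> U \<Longrightarrow> N e \<le> M * norm (snd (fst c, \<lambda>(x, v). v c) e)"
  moreover have "m * norm (v c) \<le> N (x, v)" "N (x, v) \<le> M * norm (v c)"
    if "x \<in> U" "v \<in> tangent_space A x" for x v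
    using *[of "(x, v)"] that by (simp_all add: tangent_bundle_def)
  ultimately show thesis using that by simp
next
  show "\<exists>e\<in>tangent_bundle A. fst e = y \<and> snd (fst c, \<lambda>(x, v). v c) e = w"
    if "y \<in> fst (fst c, \<lambda>(x, v). v c)" for y w
    by (rule tangent_triv_onto[OF A c(1) that])
qed (use c in simp)

lemma tangent_norm_continuous:
  assumes A: "C1_atlas A" and N: "continuous_norm (tangent_bundle A) fst (tangent_trivs A) N"
    and c: "c \<in> A" "z \<in> fst c" and w: "w \<in> tangent_space A z" and \<epsilon>: "\<epsilon> > 0"
  obtains U \<delta> where "open U" "z \<in> U" "\<delta> > 0"
    "\<And>x v. x \<in> U \<Longrightarrow> v \<in> tangent_space A x \<Longrightarrow> norm (v c - w c) < \<delta> \<Longrightarrow> \<bar>N (z, w) - N (x, v)\<bar> < \<epsilon>"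
proof (rule continuous_norm_continuous[OF N tangent_trivs_member[OF c(1)], of z "(z, w)" \<epsilon>])
  fix U \<delta>
  assume "open U" "z \<in> U" "\<delta> > 0"
    and *: "\<And>e. e \<in> tangent_bundle A \<Longrightarrow> fst e \<in> U \<Longrightarrow>
      norm (snd (fst c, \<lambda>(x, v). v c) e - snd (fst c, \<lambda>(x, v). v c) (z, w)) < \<delta> \<Longrightarrow>
      \<bar>N (z, w) - N e\<bar> < \<epsilon>"
  moreover have "\<bar>N (z, w) - N (x, v)\<bar> < \<epsilon>"
    if "x \<in> U" "v \<in> tangent_space A x" "norm (v c - w c) < \<delta>" for x v
    using *[of "(x, v)"] that by (simp add: tangent_bundle_def)
  ultimately show thesis using that by blast
next
  show "\<exists>e\<in>tangent_bundle A. fst e = y \<and> snd (fst c, \<lambda>(x, v). v c) e = u"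
    if "y \<in> fst (fst c, \<lambda>(x, v). v c)" for y u
    by (rule tangent_triv_onto[OF A c(1) that])
qed (use c w \<epsilon> in \<open>simp_all add: tangent_bundle_def\<close>)

section \<open>Curves\<close>

text \<open>The chain rule concerns
  \<open>snd d \<circ> chart_inv c \<circ> (snd c \<circ> \<alpha>)\<close>, which agrees with
  \<open>snd d \<circ> \<alpha>\<close> as long as the curve stays in \<open>c\<close>; continuity
  of \<alpha> on \<open>I\<close> provides a neighbourhood of \<open>t\<close> where it
  does.\<close>

lemma has_vector_derivative_change:
  assumes A: "C1_atlas A" and mem: "c \<in> A" "d \<in> A" "\<alpha> t \<in> fst c" "\<alpha> t \<in> fst d"
    and \<alpha>: "continuous_on I \<alpha>" "t \<in> I"
    and der: "((snd c \<circ> \<alpha>) has_vector_derivative w) (at t within I)"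
  shows "((snd d \<circ> \<alpha>) has_vector_derivative change_deriv c d (\<alpha> t) w) (at t within I)"
proof -
  have c: "is_chart c" using A mem C1_atlas_is_chart by blast
  obtain V where V: "open V" "t \<in> V" "\<And>u. u \<in> I \<Longrightarrow> u \<in> V \<Longrightarrow> \<alpha> u \<in> fst c"
    using \<alpha>[unfolded continuous_on_topological] is_chart_open(1)[OF c] mem(3) by metis
  obtain r where r: "r > 0" "ball t r \<subseteq> V" using V(1,2) open_contains_ball by blast
  have "((snd d \<circ> chart_inv c) has_derivative change_deriv c d (\<alpha> t)) (at (snd c (\<alpha> t)))"
    by (rule change_has_derivative[OF A mem])
  then have "((snd d \<circ> chart_inv c) has_derivative change_deriv c d (\<alpha> t))
      (at ((snd c \<circ> \<alpha>) t) within (snd c \<circ> \<alpha>) ` I)"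
    unfolding o_apply by (rule has_derivative_at_withinI)
  from vector_derivative_diff_chain_within[OF der this]
  show ?thesis
  proof (rule has_vector_derivative_transform_within[OF _ r(1) \<alpha>(2)])
    fix u assume "u \<in> I" "dist u t < r"
    then have "\<alpha> u \<in> fst c" using V(3) r(2) by (auto simp: dist_commute)
    then show "(snd d \<circ> chart_inv c \<circ> (snd c \<circ> \<alpha>)) u = (snd d \<circ> \<alpha>) u" using c by simp
  qed
qed

text \<open>Derivatives are taken within \<open>I\<close> so that the ends of a smooth piece are
  covered together with interior times. The filter must be nontrivial for such a derivative to be
  unique.\<close>

lemma one_sided_velocity_eq_tangent_of:
  assumes A: "C1_atlas A" and c: "c \<in> A" "\<alpha> t \<in> fst c"
    and \<alpha>: "continuous_on I \<alpha>" "t \<in> I" "at t within I \<noteq> bot"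
    and der: "((snd c \<circ> \<alpha>) has_vector_derivative w) (at t within I)"
  shows "(\<lambda>d. if d \<in> A \<and> \<alpha> t \<in> fst d then vector_derivative (snd d \<circ> \<alpha>) (at t within I) else 0)
    = tangent_of A (\<alpha> t) c w"
proof
  fix d
  show "(if d \<in> A \<and> \<alpha> t \<in> fst d then vector_derivative (snd d \<circ> \<alpha>) (at t within I) else 0)
    = tangent_of A (\<alpha> t) c w d"
  proof (cases "d \<in> A \<and> \<alpha> t \<in> fst d")
    case True
    then have "vector_derivative (snd d \<circ> \<alpha>) (at t within I) = change_deriv c d (\<alpha> t) w"
      using has_vector_derivative_change[OF A c(1) _ c(2) _ \<alpha>(1,2) der]
      by (intro vector_derivative_within[OF \<alpha>(3)]) simp
    then show ?thesis using True by (simp add: tangent_of_def)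
  next
    case False
    then show ?thesis by (auto simp: tangent_of_def)
  qed
qed

lemma velocity_eq_tangent_of:
  assumes A: "C1_atlas A" and c: "c \<in> A" "\<alpha> t \<in> fst c"
    and \<alpha>: "continuous_on I \<alpha>" "t \<in> I" "open I"
    and der: "((snd c \<circ> \<alpha>) has_vector_derivative w) (at t)"
  shows "velocity A \<alpha> t = tangent_of A (\<alpha> t) c w"
proof -
  have eq: "at t within I = at t" using \<alpha>(2,3) by (rule at_within_open)
  show ?thesis
    unfolding velocity_def
    by (rule one_sided_velocity_eq_tangent_of[OF A c \<alpha>(1,2), unfolded eq, OF _ der]) simp
qed

text \<open>The velocity may be undefined at the ends of a smooth piece. There the one-sided derivatives
  make the integrand continuous, and two points do not matter for integrability.\<close>

lemma C1_curve_integrable: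
  fixes A :: "('m::topological_space, 'a::real_normed_vector) chart set"
  assumes A: "C1_atlas A" and N: "continuous_norm (tangent_bundle A) fst (tangent_trivs A) N"
    and \<alpha>: "C1_curve_on A \<alpha> s t" and "s < t"
  shows "(\<lambda>u. N (\<alpha> u, velocity A \<alpha> u)) integrable_on {s..t}"
proof -
  define V where "V u = (\<lambda>d. if d \<in> A \<and> \<alpha> u \<in> fst d
    then vector_derivative (snd d \<circ> \<alpha>) (at u within {s..t}) else 0)" for u
  have cont: "continuous_on {s..t} \<alpha>" using \<alpha> unfolding C1_curve_on_def by blast
  \<comment> \<open>The family \<open>V u\<close> does not depend on a chart; in each chart it is
    represented by the continuous function that \<open>C1_curve_on\<close> supplies.\<close>
  have V: "\<exists>g. continuous_on ({s..t} \<inter> \<alpha> -` fst c) g \<and>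
      (\<forall>u\<in>{s..t} \<inter> \<alpha> -` fst c. V u = tangent_of A (\<alpha> u) c (g u))" if c: "c \<in> A" for c
  proof -
    obtain g where g: "continuous_on ({s..t} \<inter> \<alpha> -` fst c) g"
      "\<forall>u\<in>{s..t} \<inter> \<alpha> -` fst c. ((snd c \<circ> \<alpha>) has_vector_derivative g u) (at u within {s..t})"
      using \<alpha> c unfolding C1_curve_on_def by blast
    have "V u = tangent_of A (\<alpha> u) c (g u)" if u: "u \<in> {s..t} \<inter> \<alpha> -` fst c" for u
    proof -
      have "at u within {s..t} \<noteq> bot"
        using u \<open>s < t\<close> by (simp add: trivial_limit_within islimpt_Icc)
      from one_sided_velocity_eq_tangent_of[OF A c _ cont _ this bspec[OF g(2) u]] u
      show ?thesis by (simp add: V_def)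
    qed
    then show ?thesis using g(1) by blast
  qed
  have "continuous_on {s..t} (\<lambda>u. N (\<alpha> u, V u))"
    unfolding continuous_on_topological
  proof (intro ballI allI impI)
    fix u B assume u: "u \<in> {s..t}" and "open B" "N (\<alpha> u, V u) \<in> B"
    then obtain \<epsilon> where \<epsilon>: "\<epsilon> > 0" "ball (N (\<alpha> u, V u)) \<epsilon> \<subseteq> B" using open_contains_ball by blast
    obtain c where c: "c \<in> A" "\<alpha> u \<in> fst c" using A unfolding C1_atlas_def by blast
    obtain g where g: "continuous_on ({s..t} \<inter> \<alpha> -` fst c) g"
      "\<And>u. u \<in> {s..t} \<inter> \<alpha> -` fst c \<Longrightarrow> V u = tangent_of A (\<alpha> u) c (g u)"
      using V[OF c(1)] by blast
    have Vt: "V u \<in> tangent_space A (\<alpha> u)" "V u c = g u" if "u \<in> {s..t} \<inter> \<alpha> -` fst c" for u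
      using g(2)[OF that] that c(1) tangent_of_self[OF A c(1)] tangent_of_in_tangent_space[OF A c(1)]
      by simp_all
    have u': "u \<in> {s..t} \<inter> \<alpha> -` fst c" using u c by simp
    obtain U \<delta> where U: "open U" "\<alpha> u \<in> U" "\<delta> > 0"
      "\<And>x v. x \<in> U \<Longrightarrow> v \<in> tangent_space A x \<Longrightarrow> norm (v c - V u c) < \<delta> \<Longrightarrow>
        \<bar>N (\<alpha> u, V u) - N (x, v)\<bar> < \<epsilon>"
      by (rule tangent_norm_continuous[OF A N c Vt(1)[OF u'] \<epsilon>(1)]) simp_all
    have "open (U \<inter> fst c)" "\<alpha> u \<in> U \<inter> fst c"
      using U c is_chart_open(1)[OF C1_atlas_is_chart[OF A c(1)]] by auto
    then obtain O1 where O1: "open O1" "u \<in> O1" "\<forall>v\<in>{s..t}. v \<in> O1 \<longrightarrow> \<alpha> v \<in> U \<inter> fst c"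
      using cont[unfolded continuous_on_topological] u by meson
    obtain O2 where O2: "open O2" "u \<in> O2"
      "\<forall>v\<in>{s..t} \<inter> \<alpha> -` fst c. v \<in> O2 \<longrightarrow> g v \<in> ball (g u) \<delta>"
      using g(1)[unfolded continuous_on_topological] u' U(3)
      by (meson centre_in_ball open_ball)
    show "\<exists>G. open G \<and> u \<in> G \<and> (\<forall>y\<in>{s..t}. y \<in> G \<longrightarrow> N (\<alpha> y, V y) \<in> B)"
    proof (intro exI[of _ "O1 \<inter> O2"] conjI ballI impI)
      fix y assume y: "y \<in> {s..t}" "y \<in> O1 \<inter> O2"
      then have y': "y \<in> {s..t} \<inter> \<alpha> -` fst c" "\<alpha> y \<in> U" using O1(3) by auto
      then have "g y \<in> ball (g u) \<delta>" using O2(3) y by blast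
      then have "norm (V y c - V u c) < \<delta>"
        using Vt(2)[OF y'(1)] Vt(2)[OF u'] by (simp add: dist_norm norm_minus_commute)
      then have "\<bar>N (\<alpha> u, V u) - N (\<alpha> y, V y)\<bar> < \<epsilon>" using U(4) y'(2) Vt(1)[OF y'(1)] by blast
      then show "N (\<alpha> y, V y) \<in> B" using \<epsilon>(2) by (auto simp: dist_real_def)
    qed (use O1 O2 in auto)
  qed
  then have int: "(\<lambda>u. N (\<alpha> u, V u)) integrable_on {s..t}" by (rule integrable_continuous_real)
  have eq: "N (\<alpha> u, velocity A \<alpha> u) = N (\<alpha> u, V u)" if "u \<in> {s..t} - {s, t}" for u
  proof -
    have "at u within {s..t} = at u" using that by (intro at_within_Icc_at) auto
    show ?thesis unfolding V_def velocity_def \<open>at u within {s..t} = at u\<close> ..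
  qed
  show ?thesis by (rule integrable_spike_finite[of "{s, t}", OF _ eq int]) simp
qed

text \<open>Induction over the number of pieces, starting with none, which is why \<open>a\<close>
  may equal \<open>b\<close>. The exceptional set consists of all break points, both ends included;
  elsewhere the derivative within a piece is two-sided.\<close>

lemma piecewise_C1_curve_regularity:
  fixes A :: "('m::topological_space, 'a::real_normed_vector) chart set"
  assumes A: "C1_atlas A" and N: "continuous_norm (tangent_bundle A) fst (tangent_trivs A) N"
    and \<alpha>: "piecewise_C1_curve A \<alpha> a b"
  obtains B where "a \<le> b" "continuous_on {a..b} \<alpha>"
    "(\<lambda>u. N (\<alpha> u, velocity A \<alpha> u)) integrable_on {a..b}" "finite B"
    "\<And>t c. t \<in> {a..b} - B \<Longrightarrow> c \<in> A \<Longrightarrow> \<alpha> t \<in> fst c \<Longrightarrow>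
      \<exists>w. ((snd c \<circ> \<alpha>) has_vector_derivative w) (at t)"
proof -
  obtain n :: nat and r where r: "r 0 = a" "r n = b"
    "\<And>i. i < n \<Longrightarrow> r i < r (Suc i) \<and> C1_curve_on A \<alpha> (r i) (r (Suc i))"
    using \<alpha> unfolding piecewise_C1_curve_def by blast
  have "k \<le> n \<Longrightarrow> a \<le> r k \<and> continuous_on {a..r k} \<alpha> \<and>
    (\<lambda>u. N (\<alpha> u, velocity A \<alpha> u)) integrable_on {a..r k} \<and>
    (\<forall>t\<in>{a..r k} - r ` {..k}. \<forall>c\<in>A. \<alpha> t \<in> fst c \<longrightarrow>
      (\<exists>w. ((snd c \<circ> \<alpha>) has_vector_derivative w) (at t)))" for k
  proof (induction k)
    case 0
    show ?case using r(1) integrable_on_refl[of "\<lambda>u. N (\<alpha> u, velocity A \<alpha> u)" a] by simp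
  next
    case (Suc k)
    have step: "r k < r (Suc k)" "C1_curve_on A \<alpha> (r k) (r (Suc k))" using r(3)[of k] Suc by auto
    note IH0 = Suc.IH[OF Suc_leD[OF Suc.prems]]
    have IH: "a \<le> r k" "continuous_on {a..r k} \<alpha>"
      "(\<lambda>u. N (\<alpha> u, velocity A \<alpha> u)) integrable_on {a..r k}"
      "\<And>t c. t \<in> {a..r k} - r ` {..k} \<Longrightarrow> c \<in> A \<Longrightarrow> \<alpha> t \<in> fst c \<Longrightarrow>
        \<exists>w. ((snd c \<circ> \<alpha>) has_vector_derivative w) (at t)"
      using IH0 by blast+
    have un: "{a..r (Suc k)} = {a..r k} \<union> {r k..r (Suc k)}" using IH(1) step(1) by auto
    have "continuous_on {r k..r (Suc k)} \<alpha>" using step(2) unfolding C1_curve_on_def by blast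
    then have "continuous_on {a..r (Suc k)} \<alpha>"
      unfolding un using IH(2) by (intro continuous_on_closed_Un) auto
    moreover have "(\<lambda>u. N (\<alpha> u, velocity A \<alpha> u)) integrable_on {a..r (Suc k)}"
      by (rule Henstock_Kurzweil_Integration.integrable_combine[OF IH(1) less_imp_le[OF step(1)]
            IH(3) C1_curve_integrable[OF A N step(2,1)]])
    moreover have "\<exists>w. ((snd c \<circ> \<alpha>) has_vector_derivative w) (at t)"
      if t: "t \<in> {a..r (Suc k)} - r ` {..Suc k}" and c: "c \<in> A" "\<alpha> t \<in> fst c" for t c
    proof (cases "t \<le> r k")
      case True
      have "r ` {..k} \<subseteq> r ` {..Suc k}" by (intro image_mono) auto
      then have "t \<in> {a..r k} - r ` {..k}" using True t by auto
      then show ?thesis using IH(4) c by blast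
    next
      case False
      have "t \<noteq> r (Suc k)" using t by auto
      then have t': "r k < t" "t < r (Suc k)" using False t by auto
      then have "t \<in> {r k..r (Suc k)} \<inter> \<alpha> -` fst c" using c by auto
      then obtain w where
        "((snd c \<circ> \<alpha>) has_vector_derivative w) (at t within {r k..r (Suc k)})"
        using step(2) c(1) unfolding C1_curve_on_def by meson
      then show ?thesis using at_within_Icc_at[OF t'] by metis
    qed
    moreover have "a \<le> r (Suc k)" using IH(1) step(1) by simp
    ultimately show ?case by blast
  qed
  from this[of n] show ?thesis using r(2) by (intro that[of "r ` {..n}"]) auto
qed

text \<open>On the tangent bundle the sign follows from the local lower bound of the norm by a
  multiple of the chart norm.\<close>

lemma tangent_norm_nonneg:
  assumes A: "C1_atlas A" and N: "continuous_norm (tangent_bundle A) fst (tangent_trivs A) N"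
    and v: "v \<in> tangent_space A x"
  shows "N (x, v) \<ge> 0"
proof -
  obtain c where c: "c \<in> A" "x \<in> fst c" using A unfolding C1_atlas_def by blast
  obtain U m where "x \<in> U" "m > 0"
    "\<And>x v. x \<in> U \<Longrightarrow> v \<in> tangent_space A x \<Longrightarrow> m * norm (v c) \<le> N (x, v)"
    by (rule tangent_norm_locally_equivalent[OF A N c]) simp
  then have "m * norm (v c) \<le> N (x, v)" "0 \<le> m * norm (v c)" using v by auto
  then show ?thesis by linarith
qed

lemma velocity_in_tangent_space:
  assumes A: "C1_atlas A" and c: "c \<in> A" "\<alpha> t \<in> fst c" and \<alpha>: "continuous_on {a..b} \<alpha>" "a < t" "t < b"
    and der: "((snd c \<circ> \<alpha>) has_vector_derivative w) (at t)"
  shows "velocity A \<alpha> t \<in> tangent_space A (\<alpha> t)" "velocity A \<alpha> t c = w"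
proof -
  have "velocity A \<alpha> t = tangent_of A (\<alpha> t) c w"
    by (rule velocity_eq_tangent_of[where I = "{a<..<b}", OF A c _ _ _ der])
       (use \<alpha> in \<open>auto intro: continuous_on_subset\<close>)
  then show "velocity A \<alpha> t \<in> tangent_space A (\<alpha> t)" "velocity A \<alpha> t c = w"
    using tangent_of_self[OF A c] tangent_of_in_tangent_space[OF A c] by simp_all
qed

lemma piecewise_C1_curve_speed_nonneg:
  assumes A: "C1_atlas A" and N: "continuous_norm (tangent_bundle A) fst (tangent_trivs A) N"
    and \<alpha>: "continuous_on {a..b} \<alpha>"
    and der: "\<And>t c. t \<in> {a..b} - B \<Longrightarrow> c \<in> A \<Longrightarrow> \<alpha> t \<in> fst c \<Longrightarrow>
      \<exists>w. ((snd c \<circ> \<alpha>) has_vector_derivative w) (at t)"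
    and t: "t \<in> {a..b} - (B \<union> {a, b})"
  shows "N (\<alpha> t, velocity A \<alpha> t) \<ge> 0"
proof -
  obtain c where c: "c \<in> A" "\<alpha> t \<in> fst c" using A unfolding C1_atlas_def by blast
  obtain w where w: "((snd c \<circ> \<alpha>) has_vector_derivative w) (at t)" using der[of t c] t c by auto
  have "a < t" "t < b" using t by auto
  from velocity_in_tangent_space(1)[OF A c \<alpha> this w] show ?thesis
    by (rule tangent_norm_nonneg[OF A N])
qed

text \<open>Fundamental theorem of calculus for \<open>snd c \<circ> \<alpha>\<close>: while the
  curve stays in \<open>W\<close>, its chart velocity is dominated by the speed divided by
  \<open>m\<close>.\<close>

lemma chart_displacement_le_length:
  fixes A :: "('m::topological_space, 'a::banach) chart set"
  assumes A: "C1_atlas A" and c: "c \<in> A" and m: "m > 0"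
    and N: "\<And>x v. x \<in> W \<Longrightarrow> v \<in> tangent_space A x \<Longrightarrow> m * norm (v c) \<le> N (x, v)"
    and W: "W \<subseteq> fst c" "\<And>u. u \<in> {s..t} \<Longrightarrow> \<alpha> u \<in> W"
    and st: "s \<le> t" and cont: "continuous_on {s..t} \<alpha>"
    and int: "(\<lambda>u. N (\<alpha> u, velocity A \<alpha> u)) integrable_on {s..t}" and B: "finite B"
    and der: "\<And>u. u \<in> {s..t} - B \<Longrightarrow> \<exists>w. ((snd c \<circ> \<alpha>) has_vector_derivative w) (at u)"
  shows "m * norm (snd c (\<alpha> t) - snd c (\<alpha> s)) \<le> integral {s..t} (\<lambda>u. N (\<alpha> u, velocity A \<alpha> u))"
proof -
  \<comment> \<open>The velocity is identified only at interior times off \<open>B\<close>. Setting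
    derivative and speed to 0 on the finite set \<open>E\<close> does not affect the integrals and
    makes the pointwise bound hold on all of \<open>{s..t}\<close>.\<close>
  define E where "E = B \<union> {s, t}"
  have E: "finite E" using B by (simp add: E_def)
  define \<zeta> where "\<zeta> u = (if u \<in> E then 0 else vector_derivative (snd c \<circ> \<alpha>) (at u))" for u
  define f where "f u = (if u \<in> E then 0 else N (\<alpha> u, velocity A \<alpha> u))" for u
  have der': "((snd c \<circ> \<alpha>) has_vector_derivative \<zeta> u) (at u)" if "u \<in> {s<..<t} - E" for u
  proof -
    have "u \<in> {s..t} - B" using that by (auto simp: E_def)
    then show ?thesis using der[of u] that
      by (auto simp: \<zeta>_def vector_derivative_works[symmetric] differentiableI_vector)
  qed
  have "continuous_on {s..t} (snd c \<circ> \<alpha>)"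
    using W by (intro continuous_on_compose cont
        continuous_on_subset[OF is_chart_continuous[OF C1_atlas_is_chart[OF A c]]]) auto
  then have \<zeta>: "(\<zeta> has_integral ((snd c \<circ> \<alpha>) t - (snd c \<circ> \<alpha>) s)) {s..t}"
    by (intro fundamental_theorem_of_calculus_interior_strong[OF E st der'])
  have f: "(f has_integral integral {s..t} (\<lambda>u. N (\<alpha> u, velocity A \<alpha> u))) {s..t}"
    by (rule has_integral_spike_finite[OF E _ integrable_integral[OF int]]) (simp add: f_def)
  then have f': "((\<lambda>u. f u / m) has_integral
      integral {s..t} (\<lambda>u. N (\<alpha> u, velocity A \<alpha> u)) / m) {s..t}"
    by (rule has_integral_divide)
  have "norm (\<zeta> u) \<le> f u / m" if u: "u \<in> {s..t}" for u
  proof (cases "u \<in> E")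
    case False
    then have u': "s < u" "u < t" using u by (auto simp: E_def)
    have "\<alpha> u \<in> fst c" using W u by blast
    note v = velocity_in_tangent_space[OF A c this cont u' der'[of u]]
    have "m * norm (\<zeta> u) \<le> N (\<alpha> u, velocity A \<alpha> u)"
      using N[OF W(2)[OF u] v(1)] v(2) u' False by simp
    then show ?thesis using False m by (simp add: f_def field_simps)
  qed (simp add: \<zeta>_def f_def)
  then have "norm (integral {s..t} \<zeta>) \<le> integral {s..t} (\<lambda>u. f u / m)"
    using \<zeta> f' by (intro Henstock_Kurzweil_Integration.integral_norm_bound_integral)
      (auto simp: integrable_on_def)
  then show ?thesis
    using m integral_unique[OF \<zeta>] integral_unique[OF f'] by (simp add: field_simps)
qed

section \<open>The metric in a chart\<close>

text \<open>The image of a closed chart ball need not be closed, even in a Hausdorff manifold. The first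
  exit time is excluded by completeness instead: a curve of finite length has a limit in the chart
  when it approaches that time, and by the Hausdorff property the curve passes through it.\<close>

lemma curve_length_ge_chart_distance:
  fixes A :: "('m::t2_space, 'a::banach) chart set"
  assumes A: "C1_atlas A" and N: "continuous_norm (tangent_bundle A) fst (tangent_trivs A) N"
    and c: "c \<in> A" and m: "m > 0" and \<rho>: "ball \<xi> \<rho> \<subseteq> snd c ` fst c"
    and Nm: "\<And>x v. x \<in> fst c \<Longrightarrow> snd c x \<in> ball \<xi> \<rho> \<Longrightarrow> v \<in> tangent_space A x \<Longrightarrow>
      m * norm (v c) \<le> N (x, v)"
    and \<alpha>: "piecewise_C1_curve A \<alpha> a b" "\<alpha> a \<in> fst c" "\<alpha> b \<in> fst c" "snd c (\<alpha> b) = \<xi>"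
    and near: "norm (snd c (\<alpha> a) - \<xi>) < \<rho> / 2"
  shows "m * norm (snd c (\<alpha> a) - \<xi>) \<le> curve_length A N \<alpha> a b"
proof (rule ccontr)
  define L where "L = curve_length A N \<alpha> a b"
  define f where "f u = N (\<alpha> u, velocity A \<alpha> u)" for u
  define W where "W = fst c \<inter> snd c -` ball \<xi> \<rho>"
  assume "\<not> ?thesis"
  then have short: "L < m * norm (snd c (\<alpha> a) - \<xi>)" by (simp add: L_def)
  have ch: "is_chart c" using A c by (rule C1_atlas_is_chart)
  obtain B where B: "a \<le> b" "continuous_on {a..b} \<alpha>" "f integrable_on {a..b}" "finite B"
    "\<And>t c. t \<in> {a..b} - B \<Longrightarrow> c \<in> A \<Longrightarrow> \<alpha> t \<in> fst c \<Longrightarrow>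
      \<exists>w. ((snd c \<circ> \<alpha>) has_vector_derivative w) (at t)"
    unfolding f_def by (rule piecewise_C1_curve_regularity[OF A N \<alpha>(1)]) simp
  \<comment> \<open>\<open>J\<close> is the arc length from \<open>a\<close>. It is monotone because
    the speed is nonnegative off a finite set, and continuous as an indefinite integral.\<close>
  define J where "J t = integral {a..t} f" for t
  have int: "f integrable_on {s..t}" if "a \<le> s" "t \<le> b" for s t
    using integrable_on_subinterval[OF B(3)] that by auto
  have J_diff: "J t - J s = integral {s..t} f" if "a \<le> s" "s \<le> t" "t \<le> b" for s t
    using Henstock_Kurzweil_Integration.integral_combine[OF that(1,2) int] that by (simp add: J_def)
  have J_mono: "J s \<le> J t" if "a \<le> s" "s \<le> t" "t \<le> b" for s t
  proof -
    have "f u \<ge> 0" if "u \<in> {s..t} - (B \<union> {a, b})" for u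
      using piecewise_C1_curve_speed_nonneg[OF A N B(2,5), where t = u] that \<open>a \<le> s\<close> \<open>t \<le> b\<close>
      by (auto simp: f_def)
    then have "0 \<le> integral {s..t} (\<lambda>u. if u \<in> B \<union> {a, b} then 0 else f u)"
      by (intro Henstock_Kurzweil_Integration.integral_nonneg
          integrable_spike_finite[OF _ _ int[OF that(1,3)], of "B \<union> {a, b}"])
         (use B(4) in auto)
    also have "\<dots> = integral {s..t} f"
      by (rule integral_spike[of "B \<union> {a, b}"]) (use B(4) in \<open>auto intro: negligible_finite\<close>)
    finally show ?thesis using J_diff[OF that] by simp
  qed
  have J_cont: "continuous_on {a..b} J"
    unfolding J_def by (rule indefinite_integral_continuous_1[OF B(3)])
  have J_le: "J t \<le> L" if "t \<in> {a..b}" for t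
    using J_mono[of t b] that by (simp add: J_def L_def curve_length_def f_def[abs_def])
  have J_a: "J a = 0" by (simp add: J_def)
  have disp: "m * norm (snd c (\<alpha> t) - snd c (\<alpha> s)) \<le> J t - J s"
    if "a \<le> s" "s \<le> t" "t \<le> b" and W: "\<And>u. u \<in> {s..t} \<Longrightarrow> \<alpha> u \<in> W" for s t
    unfolding J_diff[OF that(1-3)] unfolding f_def
  proof (rule chart_displacement_le_length[OF A c m, of W])
    show "continuous_on {s..t} \<alpha>" using B(2) by (rule continuous_on_subset) (use that in auto)
    show "(\<lambda>u. N (\<alpha> u, velocity A \<alpha> u)) integrable_on {s..t}"
      using int[OF that(1,3)] by (simp add: f_def[abs_def])
    show "\<exists>w. (snd c \<circ> \<alpha> has_vector_derivative w) (at u)" if "u \<in> {s..t} - B" for u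
      using B(5)[of u c] W[of u] that \<open>a \<le> s\<close> \<open>t \<le> b\<close> c by (auto simp: W_def)
  qed (use that Nm B(4) in \<open>auto simp: W_def\<close>)
  \<comment> \<open>The times up to which the curve has not left the chart ball. Once the supremum
    \<open>T\<close> is known to lie in \<open>S\<close>, the case \<open>T = b\<close> contradicts
    the shortness of the curve, which would have reached \<xi>, and \<open>T < b\<close> contradicts
    the openness of \<open>W\<close>.\<close>
  define S where "S = {t \<in> {a..b}. \<forall>u\<in>{a..t}. \<alpha> u \<in> W}"
  have \<rho>': "\<rho> > 0" using near norm_ge_zero[of "snd c (\<alpha> a) - \<xi>"] by linarith
  have "\<alpha> a \<in> W" using near \<alpha>(2) \<rho>' by (simp add: W_def dist_norm norm_minus_commute)
  then have aS: "a \<in> S" using B(1) by (simp add: S_def)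
  have S_le: "norm (snd c (\<alpha> t) - snd c (\<alpha> a)) \<le> L / m" if "t \<in> S" for t
  proof -
    have "m * norm (snd c (\<alpha> t) - snd c (\<alpha> a)) \<le> J t - J a"
      by (rule disp) (use that in \<open>auto simp: S_def\<close>)
    also have "\<dots> \<le> L" using J_le[of t] that J_a by (auto simp: S_def)
    finally show ?thesis using m by (simp add: field_simps)
  qed
  have Lm: "L / m < norm (snd c (\<alpha> a) - \<xi>)" using short m by (simp add: field_simps)
  define T where "T = Sup S"
  have bdd: "bdd_above S" by (rule bdd_aboveI[of _ b]) (simp add: S_def)
  have aT: "a \<le> T" unfolding T_def by (rule cSup_upper[OF aS bdd])
  have Tb: "T \<le> b" unfolding T_def by (rule cSup_least) (use aS in \<open>auto simp: S_def\<close>)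
  have lt_T: "t \<in> S" if "a \<le> t" "t < T" for t
  proof -
    obtain s where "s \<in> S" "t < s" using less_cSupD[of S t] aS \<open>t < T\<close> unfolding T_def by auto
    then show ?thesis using \<open>a \<le> t\<close> by (auto simp: S_def)
  qed
  have "\<alpha> T \<in> W"
  proof (cases "T = a")
    case True
    then show ?thesis using \<open>\<alpha> a \<in> W\<close> by simp
  next
    case False
    then have "a < T" using aT by simp
    \<comment> \<open>Times in \<open>S\<close> that increase to \<open>T\<close>, beginning with
      \<open>t 0 = a\<close>.\<close>
    define t where "t n = T - (T - a) / real (Suc n)" for n
    have t_mem: "a \<le> t n" "t n < T" for n
    proof -
      have "(T - a) / real (Suc n) \<le> (T - a) / 1"
        using \<open>a < T\<close> by (intro divide_left_mono) auto
      then show "a \<le> t n" by (simp add: t_def del: of_nat_Suc)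
      show "t n < T" using \<open>a < T\<close> by (simp add: t_def)
    qed
    have t_S: "t n \<in> S" for n using lt_T t_mem by blast
    have t_lim: "t \<longlonglongrightarrow> T"
    proof -
      have "(\<lambda>n. T - (T - a) * inverse (real (Suc n))) \<longlonglongrightarrow> T - (T - a) * 0"
        by (intro tendsto_intros LIMSEQ_inverse_real_of_nat)
      then show ?thesis by (simp add: t_def[abs_def] divide_inverse)
    qed
    have "(\<lambda>n. J (t n)) \<longlonglongrightarrow> J T"
      using J_cont t_lim t_mem aT Tb
      by (intro continuous_on_tendsto_compose[OF J_cont t_lim]) (auto intro!: always_eventually less_imp_le order_trans[OF less_imp_le Tb])
    then have "Cauchy (\<lambda>n. J (t n))" by (rule LIMSEQ_imp_Cauchy)
    \<comment> \<open>Chart displacements are bounded by increments of \<open>J\<close> divided by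
      \<open>m\<close>, and \<open>J (t n)\<close> converges; completeness of the model space then
      yields the limit \<eta>.\<close>
    have "Cauchy (\<lambda>n. snd c (\<alpha> (t n)))"
    proof (rule metric_CauchyI)
      fix \<epsilon> :: real assume "\<epsilon> > 0"
      then obtain M where M: "\<And>i j. i \<ge> M \<Longrightarrow> j \<ge> M \<Longrightarrow> dist (J (t i)) (J (t j)) < m * \<epsilon>"
        using metric_CauchyD[OF \<open>Cauchy (\<lambda>n. J (t n))\<close>, of "m * \<epsilon>"] m by auto
      have le: "m * dist (snd c (\<alpha> (t i))) (snd c (\<alpha> (t j))) \<le> dist (J (t i)) (J (t j))"
        if "t i \<le> t j" for i j
        using disp[of "t i" "t j"] that t_S[of i] t_S[of j]
        by (auto simp: S_def dist_norm norm_minus_commute)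
      have "m * dist (snd c (\<alpha> (t i))) (snd c (\<alpha> (t j))) \<le> dist (J (t i)) (J (t j))" for i j
        using le[of i j] le[of j i] by (cases "t i \<le> t j") (auto simp: dist_commute)
      then have "m * dist (snd c (\<alpha> (t i))) (snd c (\<alpha> (t j))) < m * \<epsilon>" if "i \<ge> M" "j \<ge> M" for i j
        using M[OF that] by (meson order_le_less_trans)
      then show "\<exists>M. \<forall>i\<ge>M. \<forall>j\<ge>M. dist (snd c (\<alpha> (t i))) (snd c (\<alpha> (t j))) < \<epsilon>"
        using m by auto
    qed
    then obtain \<eta> where \<eta>: "(\<lambda>n. snd c (\<alpha> (t n))) \<longlonglongrightarrow> \<eta>"
      using Cauchy_convergent_iff convergent_def by blast
    have "norm (\<eta> - snd c (\<alpha> a)) \<le> L / m"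
      by (rule Lim_bounded[OF tendsto_norm[OF tendsto_diff[OF \<eta> tendsto_const]], of 0])
         (use S_le t_S in auto)
    \<comment> \<open>The distance of the start from \<xi> and the displacement are each less than
      \<open>\<rho> / 2\<close>, so the limit lies in the open ball. This explains the radius in the
      premise on \<open>\<alpha> a\<close>.\<close>
    then have "norm (\<eta> - snd c (\<alpha> a)) < \<rho> / 2" using Lm near by linarith
    moreover have "norm (\<eta> - \<xi>) \<le> norm (\<eta> - snd c (\<alpha> a)) + norm (snd c (\<alpha> a) - \<xi>)"
      using norm_triangle_ineq[of "\<eta> - snd c (\<alpha> a)" "snd c (\<alpha> a) - \<xi>"] by simp
    ultimately have \<eta>_ball: "\<eta> \<in> ball \<xi> \<rho>"
      using near by (simp add: dist_norm norm_minus_commute)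
    then have \<eta>_im: "\<eta> \<in> snd c ` fst c" using \<rho> by blast
    have "(\<lambda>n. chart_inv c (snd c (\<alpha> (t n)))) \<longlonglongrightarrow> chart_inv c \<eta>"
    proof (rule continuous_on_tendsto_compose[OF is_chart_inv_continuous[OF ch] \<eta> \<eta>_im])
      have "\<alpha> (t n) \<in> fst c" for n using t_S[of n] by (auto simp: S_def W_def)
      then show "\<forall>\<^sub>F n in sequentially. snd c (\<alpha> (t n)) \<in> snd c ` fst c" by simp
    qed
    moreover have "chart_inv c (snd c (\<alpha> (t n))) = \<alpha> (t n)" for n
      using t_S[of n] ch by (auto simp: S_def W_def)
    ultimately have "(\<lambda>n. \<alpha> (t n)) \<longlonglongrightarrow> chart_inv c \<eta>" by simp
    moreover have "(\<lambda>n. \<alpha> (t n)) \<longlonglongrightarrow> \<alpha> T"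
      using t_S aT Tb by (intro continuous_on_tendsto_compose[OF B(2) t_lim]) (auto simp: S_def)
    \<comment> \<open>The Hausdorff property enters here: both are limits of the same
      sequence.\<close>
    ultimately have "\<alpha> T = chart_inv c \<eta>" by (rule LIMSEQ_unique[OF _ _, rotated])
    then show ?thesis using \<eta>_im \<eta>_ball by (simp add: W_def chart_chart_inv chart_inv_into)
  qed
  then have T_S: "T \<in> S"
    using lt_T aT Tb by (auto simp: S_def) (metis atLeastAtMost_iff order_refl order_less_le)
  show False
  proof (cases "T = b")
    case True
    then have "norm (\<xi> - snd c (\<alpha> a)) \<le> L / m" using S_le[OF T_S] \<alpha>(4) by simp
    then show False using Lm by (simp add: norm_minus_commute)
  next
    case False
    have "open W" unfolding W_def by (rule is_chart_vimage_open[OF ch open_ball])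
    then obtain G where G: "open G" "T \<in> G" "\<forall>u\<in>{a..b}. u \<in> G \<longrightarrow> \<alpha> u \<in> W"
      using B(2)[unfolded continuous_on_topological] aT Tb \<open>\<alpha> T \<in> W\<close> by (metis atLeastAtMost_iff)
    obtain r where r: "r > 0" "ball T r \<subseteq> G" using G open_contains_ball by blast
    define s where "s = min b (T + r / 2)"
    have s: "T < s" "s \<le> b" "s < T + r" using False Tb r(1) by (auto simp: s_def min_def)
    have "\<alpha> u \<in> W" if "u \<in> {a..s}" for u
    proof (cases "u \<le> T")
      case True
      then show ?thesis using T_S that by (auto simp: S_def)
    next
      case False
      then have "u \<in> ball T r" using that s by (auto simp: dist_real_def)
      then show ?thesis using G(3) r(2) that s by auto
    qed
    then have "s \<in> S" using s aT by (auto simp: S_def)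
    then show False using cSup_upper[OF _ bdd] s(1) unfolding T_def by force
  qed
qed

lemma chart_segment_curve:
  fixes A :: "('m::topological_space, 'a::real_normed_vector) chart set"
  assumes A: "C1_atlas A" and c: "c \<in> A" and \<rho>: "ball \<xi> \<rho> \<subseteq> snd c ` fst c"
    and NM: "\<And>x v. x \<in> fst c \<Longrightarrow> snd c x \<in> ball \<xi> \<rho> \<Longrightarrow> v \<in> tangent_space A x \<Longrightarrow>
      N (x, v) \<le> M * norm (v c)"
    and M: "M > 0"
    and x: "x \<in> fst c" "norm (snd c x - \<xi>) < \<rho>"
  obtains \<alpha> where "piecewise_C1_curve A \<alpha> 0 1" "\<alpha> 0 = x" "\<alpha> 1 = chart_inv c \<xi>"
    "curve_length A N \<alpha> 0 1 \<le> M * norm (snd c x - \<xi>)"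
proof -
  have ch: "is_chart c" using A c by (rule C1_atlas_is_chart)
  define h where "h = \<xi> - snd c x"
  define \<gamma> where "\<gamma> u = snd c x + u *\<^sub>R h" for u :: real
  define \<alpha> where "\<alpha> u = chart_inv c (\<gamma> u)" for u
  \<comment> \<open>An open set of times containing \<open>{0..1}\<close>. The segment is prolonged
    slightly beyond its ends, so that the two-sided velocity exists there as well.\<close>
  define I where "I = \<gamma> -` ball \<xi> \<rho>"
  have \<gamma>_cont: "continuous_on UNIV \<gamma>" unfolding \<gamma>_def by (intro continuous_intros)
  have "open I" unfolding I_def by (rule open_vimage[OF open_ball \<gamma>_cont])
  have sub: "{0..1} \<subseteq> I"
  proof
    fix u :: real assume u: "u \<in> {0..1}"
    have "\<gamma> u - \<xi> = (1 - u) *\<^sub>R (snd c x - \<xi>)" by (simp add: \<gamma>_def h_def algebra_simps)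
    then have "norm (\<gamma> u - \<xi>) = (1 - u) * norm (snd c x - \<xi>)" using u by simp
    also have "\<dots> \<le> 1 * norm (snd c x - \<xi>)" using u by (intro mult_right_mono) auto
    finally show "u \<in> I" using x(2) by (simp add: I_def dist_norm norm_minus_commute)
  qed
  have I: "\<gamma> u \<in> snd c ` fst c" "\<alpha> u \<in> fst c" "snd c (\<alpha> u) = \<gamma> u" "snd c (\<alpha> u) \<in> ball \<xi> \<rho>"
    if "u \<in> I" for u
  proof -
    show im: "\<gamma> u \<in> snd c ` fst c" using that \<rho> by (auto simp: I_def)
    show "\<alpha> u \<in> fst c" "snd c (\<alpha> u) = \<gamma> u"
      using im by (simp_all add: \<alpha>_def chart_inv_into chart_chart_inv)
    then show "snd c (\<alpha> u) \<in> ball \<xi> \<rho>" using that by (simp add: I_def)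
  qed
  have \<alpha>_cont: "continuous_on I \<alpha>"
    unfolding \<alpha>_def
    by (rule continuous_on_compose2[OF is_chart_inv_continuous[OF ch]])
       (use I(1) \<gamma>_cont in \<open>auto intro: continuous_on_subset\<close>)
  have \<gamma>_der: "(\<gamma> has_vector_derivative h) (at u)" for u
    unfolding \<gamma>_def by (auto intro!: derivative_eq_intros)
  have der: "((snd c \<circ> \<alpha>) has_vector_derivative h) (at u)" if "u \<in> I" for u
    by (rule has_vector_derivative_transform_within_open[OF \<gamma>_der \<open>open I\<close> that]) (simp add: I(3))
  have "C1_curve_on A \<alpha> 0 1"
    unfolding C1_curve_on_def
  proof (intro conjI ballI)
    show "continuous_on {0..1} \<alpha>" using \<alpha>_cont sub by (rule continuous_on_subset)
    fix d assume d: "d \<in> A"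
    then have "C1_on (snd d \<circ> chart_inv c) (snd c ` (fst c \<inter> fst d))"
      using A c by (simp add: C1_atlas_def C1_compatible_def)
    then obtain f' where f': "\<forall>\<xi>\<in>snd c ` (fst c \<inter> fst d).
      ((snd d \<circ> chart_inv c) has_derivative blinfun_apply (f' \<xi>)) (at \<xi>)"
      "continuous_on (snd c ` (fst c \<inter> fst d)) f'"
      unfolding C1_on_def by (elim exE conjE)
    have mem: "\<gamma> u \<in> snd c ` (fst c \<inter> fst d)" if "u \<in> {0..1} \<inter> \<alpha> -` fst d" for u
    proof -
      have "u \<in> I" using that sub by blast
      then show ?thesis using I(2,3)[of u] that by (intro image_eqI[of _ _ "\<alpha> u"]) auto
    qed
    show "\<exists>g. continuous_on ({0..1} \<inter> \<alpha> -` fst d) g \<and>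
      (\<forall>u\<in>{0..1} \<inter> \<alpha> -` fst d. (snd d \<circ> \<alpha> has_vector_derivative g u) (at u within {0..1}))"
    proof (intro exI[of _ "\<lambda>u. blinfun_apply (f' (\<gamma> u)) h"] conjI ballI)
      have "continuous_on ({0..1} \<inter> \<alpha> -` fst d) (\<lambda>u. f' (\<gamma> u))"
        by (rule continuous_on_compose2[OF f'(2)])
           (use mem \<gamma>_cont in \<open>auto intro: continuous_on_subset\<close>)
      then show "continuous_on ({0..1} \<inter> \<alpha> -` fst d) (\<lambda>u. blinfun_apply (f' (\<gamma> u)) h)"
        by (intro continuous_intros)
      fix u assume u: "u \<in> {0..1} \<inter> \<alpha> -` fst d"
      from bspec[OF f'(1) mem[OF u]]
      have "((snd d \<circ> chart_inv c) has_derivative blinfun_apply (f' (\<gamma> u))) (at (\<gamma> u) within \<gamma> ` {0..1})"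
        by (rule has_derivative_at_withinI)
      from vector_derivative_diff_chain_within[OF has_vector_derivative_at_within[OF \<gamma>_der] this]
      show "(snd d \<circ> \<alpha> has_vector_derivative blinfun_apply (f' (\<gamma> u)) h) (at u within {0..1})"
        by (simp add: \<alpha>_def o_def)
    qed
  qed
  \<comment> \<open>A single piece, with break points \<open>real 0 = 0\<close> and
    \<open>real 1 = 1\<close>.\<close>
  then have "piecewise_C1_curve A \<alpha> 0 1"
    unfolding piecewise_C1_curve_def by (intro exI[of _ "1::nat"] exI[of _ real]) simp
  moreover have "\<alpha> 0 = x" "\<alpha> 1 = chart_inv c \<xi>" using ch x by (simp_all add: \<alpha>_def \<gamma>_def h_def)
  moreover have "curve_length A N \<alpha> 0 1 \<le> M * norm (snd c x - \<xi>)"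
  proof -
    have le: "N (\<alpha> u, velocity A \<alpha> u) \<le> M * norm h" if "u \<in> {0..1}" for u
    proof -
      have u: "u \<in> I" using that sub by blast
      have "velocity A \<alpha> u = tangent_of A (\<alpha> u) c h"
        by (rule velocity_eq_tangent_of[OF A c I(2)[OF u] \<alpha>_cont u \<open>open I\<close> der[OF u]])
      then have "velocity A \<alpha> u \<in> tangent_space A (\<alpha> u)" "velocity A \<alpha> u c = h"
        using tangent_of_self[OF A c I(2)[OF u]] tangent_of_in_tangent_space[OF A c I(2)[OF u]]
        by simp_all
      then show ?thesis using NM[OF I(2)[OF u] I(4)[OF u]] by metis
    qed
    \<comment> \<open>A function that is not integrable has integral 0 by convention, so the bound
      holds in that case too.\<close>
    have "integral {0..1} (\<lambda>u. N (\<alpha> u, velocity A \<alpha> u)) \<le> M * norm h"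
    proof (cases "(\<lambda>u. N (\<alpha> u, velocity A \<alpha> u)) integrable_on {0..1}")
      case True
      then have "integral {0..1} (\<lambda>u. N (\<alpha> u, velocity A \<alpha> u)) \<le> integral {0..1::real} (\<lambda>_. M * norm h)"
        by (rule integral_le) (use le in auto)
      then show ?thesis by simp
    next
      case False
      then show ?thesis using M by (simp add: not_integrable_integral)
    qed
    then show ?thesis by (simp add: curve_length_def h_def norm_minus_commute)
  qed
  ultimately show ?thesis by (rule that)
qed

text \<open>The lower bound has to hold for every connecting curve, also for one that leaves the
  chart; the upper bound needs a single curve, the segment in the chart. That segment also makes the
  set of lengths nonempty, so that a lower bound of its elements is one of its infimum.\<close>

lemma manifold_dist_locally_equivalent:
  fixes A :: "('m::t2_space, 'a::banach) chart set"
  assumes A: "C1_atlas A" and N: "continuous_norm (tangent_bundle A) fst (tangent_trivs A) N"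
    and c: "c \<in> A" "z \<in> fst c"
  obtains r m M where "r > 0" "m > 0" "M > 0"
    "\<And>x. x \<in> fst c \<Longrightarrow> norm (snd c x - snd c z) < r \<Longrightarrow>
      m * norm (snd c x - snd c z) \<le> manifold_dist A N x z"
    "\<And>x. x \<in> fst c \<Longrightarrow> norm (snd c x - snd c z) < r \<Longrightarrow>
      manifold_dist A N x z \<le> M * norm (snd c x - snd c z)"
proof -
  have ch: "is_chart c" using A c(1) by (rule C1_atlas_is_chart)
  obtain U m M where U: "open U" "z \<in> U" "U \<subseteq> fst c" and mM: "m > 0" "M > 0"
    and Nm: "\<And>x v. x \<in> U \<Longrightarrow> v \<in> tangent_space A x \<Longrightarrow> m * norm (v c) \<le> N (x, v)"
    and NM: "\<And>x v. x \<in> U \<Longrightarrow> v \<in> tangent_space A x \<Longrightarrow> N (x, v) \<le> M * norm (v c)"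
    by (rule tangent_norm_locally_equivalent[OF A N c]) simp
  have "open (snd c ` (fst c \<inter> U))" "snd c z \<in> snd c ` (fst c \<inter> U)"
    using is_chart_image_open[OF ch U(1)] U c by auto
  then obtain \<rho> where \<rho>: "\<rho> > 0" "ball (snd c z) \<rho> \<subseteq> snd c ` (fst c \<inter> U)"
    using open_contains_ball by blast
  have in_U: "x \<in> U" if x: "x \<in> fst c" "snd c x \<in> ball (snd c z) \<rho>" for x
  proof -
    obtain y where "y \<in> fst c" "y \<in> U" "snd c x = snd c y" using x(2) \<rho>(2) by blast
    then show ?thesis using chart_inv_chart[OF ch] x(1) by metis
  qed
  have \<rho>': "ball (snd c z) \<rho> \<subseteq> snd c ` fst c" using \<rho>(2) by blast
  \<comment> \<open>Half the radius, because the lower bound on lengths requires a start within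
    \<open>\<rho> / 2\<close> of the centre.\<close>
  have "m * norm (snd c x - snd c z) \<le> manifold_dist A N x z \<and>
      manifold_dist A N x z \<le> M * norm (snd c x - snd c z)"
    if x: "x \<in> fst c" "norm (snd c x - snd c z) < \<rho> / 2" for x
  proof -
    let ?L = "{curve_length A N \<alpha> a b |\<alpha> a b. piecewise_C1_curve A \<alpha> a b \<and> \<alpha> a = x \<and> \<alpha> b = z}"
    have lower: "m * norm (snd c x - snd c z) \<le> l" if l: "l \<in> ?L" for l
    proof -
      obtain \<alpha> a b where \<alpha>: "l = curve_length A N \<alpha> a b" "piecewise_C1_curve A \<alpha> a b" "\<alpha> a = x" "\<alpha> b = z"
        using l by blast
      show ?thesis
        using curve_length_ge_chart_distance[OF A N c(1) mM(1) \<rho>' _ \<alpha>(2)] \<alpha> x c(2) Nm in_U by simp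
    qed
    have x\<rho>: "norm (snd c x - snd c z) < \<rho>" using x(2) \<rho>(1) by simp
    obtain \<alpha> where \<alpha>: "piecewise_C1_curve A \<alpha> 0 1" "\<alpha> 0 = x" "\<alpha> 1 = chart_inv c (snd c z)"
      "curve_length A N \<alpha> 0 1 \<le> M * norm (snd c x - snd c z)"
      by (rule chart_segment_curve[OF A c(1) \<rho>' NM[OF in_U] mM(2) x(1) x\<rho>])
    then have mem: "curve_length A N \<alpha> 0 1 \<in> ?L" using c(2) ch by auto
    have "m * norm (snd c x - snd c z) \<le> manifold_dist A N x z"
      unfolding manifold_dist_def by (rule cInf_greatest) (use mem lower in blast)+
    moreover have "manifold_dist A N x z \<le> curve_length A N \<alpha> 0 1"
      unfolding manifold_dist_def by (rule cInf_lower[OF mem bdd_belowI[OF lower]])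
    ultimately show ?thesis using \<alpha>(4) by linarith
  qed
  then show ?thesis using that[of "\<rho> / 2" m M] \<rho>(1) mM by simp
qed

section \<open>Vector bundles\<close>

text \<open>Stated with \<open>UNIV\<close> as the total space to match the surjectivity premise of
  the lemmas on continuous norms.\<close>

lemma bundle_fibre_onto:
  assumes "C1_vector_bundle AY p TR" "s \<in> TR" "y \<in> fst s"
  shows "\<exists>e\<in>UNIV. p e = y \<and> snd s e = w"
proof -
  obtain g where "homeomorphism (p -` fst s) (fst s \<times> UNIV) (\<lambda>e. (p e, snd s e)) g"
    using assms(1,2) unfolding C1_vector_bundle_def by blast
  then have "(\<lambda>e. (p e, snd s e)) ` (p -` fst s) = fst s \<times> UNIV" by (rule homeomorphism_image1)
  moreover have "(y, w) \<in> fst s \<times> UNIV" using assms(3) by simp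
  ultimately obtain e where "(y, w) = (p e, snd s e)" by blast
  then show ?thesis by auto
qed

lemma bundle_fibre_inj:
  assumes "C1_vector_bundle AY p TR" "s \<in> TR" "p e \<in> fst s" "p e' = p e" "snd s e' = snd s e"
  shows "e' = e"
proof -
  obtain g where "homeomorphism (p -` fst s) (fst s \<times> UNIV) (\<lambda>e. (p e, snd s e)) g"
    using assms(1,2) unfolding C1_vector_bundle_def by blast
  then have "inj_on (\<lambda>e. (p e, snd s e)) (p -` fst s)"
    by (intro inj_on_inverseI[of _ g] homeomorphism_apply1)
  then show ?thesis by (rule inj_onD) (use assms(3-5) in simp_all)
qed

lemma bundle_transition_linear:
  fixes AY :: "('y::topological_space, 'b::real_normed_vector) chart set"
    and p :: "'e::topological_space \<Rightarrow> 'y" and TR :: "('y, 'e, 'v::real_normed_vector) triv set"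
  assumes E: "C1_vector_bundle AY p TR" and AY: "C1_atlas AY"
    and s: "s \<in> TR" "t \<in> TR" "y \<in> fst s" "y \<in> fst t"
  obtains G where "linear G" "\<And>e. p e = y \<Longrightarrow> snd t e = G (snd s e)"
proof -
  obtain c where c: "c \<in> AY" "y \<in> fst c" using AY unfolding C1_atlas_def by blast
  have "\<forall>s\<in>TR. \<forall>t\<in>TR. \<forall>c\<in>AY. \<exists>G :: 'b \<Rightarrow> 'v \<Rightarrow>\<^sub>L 'v.
        C1_on G (snd c ` (fst c \<inter> fst s \<inter> fst t)) \<and>
        (\<forall>e. p e \<in> fst c \<inter> fst s \<inter> fst t \<longrightarrow> snd t e = blinfun_apply (G (snd c (p e))) (snd s e))"
    using E unfolding C1_vector_bundle_def by (elim conjE)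
  from bspec[OF bspec[OF bspec[OF this s(1)] s(2)] c(1)] obtain G :: "'b \<Rightarrow> 'v \<Rightarrow>\<^sub>L 'v" where
    "\<forall>e. p e \<in> fst c \<inter> fst s \<inter> fst t \<longrightarrow> snd t e = blinfun_apply (G (snd c (p e))) (snd s e)"
    by (elim exE conjE)
  then show ?thesis
    using s(3,4) c(2) by (intro that[of "blinfun_apply (G (snd c y))"])
      (auto intro: bounded_linear.linear blinfun.bounded_linear_right)
qed

text \<open>The element with the right representative in one trivialization satisfies the
  description in \<open>fibre_add\<close>: transitions are linear on fibres, so its representatives
  are right in all trivializations, and one representative determines an element of the
  fibre.\<close>

lemma fibre_add_triv:
  assumes E: "C1_vector_bundle AY p TR" and AY: "C1_atlas AY"
    and s: "s \<in> TR" "p e \<in> fst s" and e': "p e' = p e"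
  shows "p (fibre_add p TR e e') = p e"
    and "snd s (fibre_add p TR e e') = snd s e + snd s e'"
proof -
  obtain e'' where e'': "p e'' = p e" "snd s e'' = snd s e + snd s e'"
    using bundle_fibre_onto[OF E s] by blast
  have "snd t e'' = snd t e + snd t e'" if t: "t \<in> TR" "p e \<in> fst t" for t
  proof -
    obtain G where G: "linear G" "\<And>f. p f = p e \<Longrightarrow> snd t f = G (snd s f)"
      by (rule bundle_transition_linear[OF E AY s(1) t(1) s(2) t(2)]) simp
    show ?thesis using G(2)[OF e''(1)] G(2)[OF refl] G(2)[OF e'] e''(2) linear_add[OF G(1)] by simp
  qed
  then have all: "\<forall>t\<in>TR. p e \<in> fst t \<longrightarrow> snd t e'' = snd t e + snd t e'" by blast
  have "fibre_add p TR e e' = e''"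
    unfolding fibre_add_def
  proof (rule the_equality)
    show "p e'' = p e \<and> (\<forall>t\<in>TR. p e \<in> fst t \<longrightarrow> snd t e'' = snd t e + snd t e')"
      using all e''(1) by blast
    fix f assume "p f = p e \<and> (\<forall>t\<in>TR. p e \<in> fst t \<longrightarrow> snd t f = snd t e + snd t e')"
    then show "f = e''" using e'' s by (intro bundle_fibre_inj[OF E s(1)]) auto
  qed
  then show "p (fibre_add p TR e e') = p e" "snd s (fibre_add p TR e e') = snd s e + snd s e'"
    using e'' by simp_all
qed

lemma fibre_zero_triv:
  assumes E: "C1_vector_bundle AY p TR" and AY: "C1_atlas AY" and s: "s \<in> TR" "y \<in> fst s"
  shows "p (fibre_zero p TR y) = y" and "snd s (fibre_zero p TR y) = 0"
proof -
  obtain e where e: "p e = y" "snd s e = 0" using bundle_fibre_onto[OF E s] by blast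
  have "snd t e = 0" if t: "t \<in> TR" "y \<in> fst t" for t
  proof -
    obtain G where G: "linear G" "\<And>f. p f = y \<Longrightarrow> snd t f = G (snd s f)"
      by (rule bundle_transition_linear[OF E AY s(1) t(1) s(2) t(2)]) simp
    show ?thesis using G(2)[OF e(1)] e(2) linear_0[OF G(1)] by simp
  qed
  then have all: "\<forall>t\<in>TR. y \<in> fst t \<longrightarrow> snd t e = 0" by blast
  have "fibre_zero p TR y = e"
    unfolding fibre_zero_def
  proof (rule the_equality)
    show "p e = y \<and> (\<forall>t\<in>TR. y \<in> fst t \<longrightarrow> snd t e = 0)" using all e(1) by blast
    fix f assume "p f = y \<and> (\<forall>t\<in>TR. y \<in> fst t \<longrightarrow> snd t f = 0)"
    then show "f = e" using e s by (intro bundle_fibre_inj[OF E s(1)]) auto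
  qed
  then show "p (fibre_zero p TR y) = y" "snd s (fibre_zero p TR y) = 0" using e by simp_all
qed

section \<open>Product charts of the total space\<close>

lemma homeomorphism_inv_into:
  assumes "homeomorphism S T f g"
  shows "homeomorphism S T f (inv_into S f)"
proof (rule homeomorphism_cong[OF assms refl refl refl])
  fix y assume y: "y \<in> T"
  have inj: "inj_on f S" by (rule inj_on_inverseI[of _ g]) (rule homeomorphism_apply1[OF assms])
  have "g y \<in> S" "f (g y) = y" using assms y by (auto simp: homeomorphism_def)
  then show "inv_into S f y = g y" using inv_into_f_f[OF inj] by metis
qed

lemma bundle_chart_image:
  fixes AY :: "('y::topological_space, 'b::real_normed_vector) chart set"
    and p :: "'e::topological_space \<Rightarrow> 'y" and TR :: "('y, 'e, 'v::real_normed_vector) triv set"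
    and c :: "('y, 'c) chart"
  assumes E: "C1_vector_bundle AY p TR" and s: "s \<in> TR" and U: "U \<subseteq> fst c \<inter> fst s"
  shows "snd (bundle_chart p c s) ` (p -` U) = (snd c ` U) \<times> UNIV"
proof (intro set_eqI iffI)
  fix z :: "'c \<times> 'v" assume "z \<in> snd c ` U \<times> UNIV"
  then obtain y where y: "y \<in> U" "fst z = snd c y" by auto
  then obtain e where "p e = y" "snd s e = snd z" using bundle_fibre_onto[OF E s] U by blast
  then show "z \<in> snd (bundle_chart p c s) ` (p -` U)"
    using y by (intro image_eqI[of _ _ e]) (auto simp: bundle_chart_def prod_eq_iff)
qed (auto simp: bundle_chart_def)

lemma is_chart_bundle_chart:
  assumes E: "C1_vector_bundle AY p TR" and s: "s \<in> TR" and c: "is_chart c"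
  shows "is_chart (bundle_chart p c s)"
proof -
  let ?b = "bundle_chart p c s"
  have p: "continuous_on UNIV p" using E unfolding C1_vector_bundle_def by blast
  have os: "open (fst s)" using E s unfolding C1_vector_bundle_def by blast
  obtain g where g: "homeomorphism (p -` fst s) (fst s \<times> UNIV) (\<lambda>e. (p e, snd s e)) g"
    using E s unfolding C1_vector_bundle_def by blast
  have dom: "fst ?b = p -` (fst c \<inter> fst s)" by (simp add: bundle_chart_def)
  have im: "snd ?b ` fst ?b = snd c ` (fst c \<inter> fst s) \<times> UNIV"
    unfolding dom by (rule bundle_chart_image[OF E s order_refl])
  have "open (fst ?b)" unfolding dom using p os is_chart_open(1)[OF c] by (simp add: open_vimage open_Int)
  moreover have "open (snd ?b ` fst ?b)"
    unfolding im by (intro open_Times is_chart_image_open[OF c os] open_UNIV)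
  moreover have "homeomorphism (fst ?b) (snd ?b ` fst ?b) (snd ?b) (\<lambda>(\<xi>, w). g (chart_inv c \<xi>, w))"
  proof (rule homeomorphismI)
    have ps: "continuous_on (p -` fst s) (\<lambda>e. snd (p e, snd s e))"
      by (rule continuous_on_snd[OF homeomorphism_cont1[OF g]])
    have "continuous_on (fst ?b) (\<lambda>e. snd s e)"
      using ps unfolding dom snd_conv by (rule continuous_on_subset) auto
    moreover have "continuous_on (fst ?b) (\<lambda>e. snd c (p e))"
      by (rule continuous_on_compose2[OF is_chart_continuous[OF c] continuous_on_subset[OF p]])
         (auto simp: dom)
    ultimately show "continuous_on (fst ?b) (snd ?b)"
      by (simp add: bundle_chart_def continuous_on_Pair)
    have "continuous_on (snd ?b ` fst ?b) (\<lambda>z. (chart_inv c (fst z), snd z))"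
      unfolding im by (intro continuous_on_Pair continuous_on_snd[OF continuous_on_id]
          continuous_on_compose2[OF is_chart_inv_continuous[OF c] continuous_on_fst[OF continuous_on_id]])
        auto
    then show "continuous_on (snd ?b ` fst ?b) (\<lambda>(\<xi>, w). g (chart_inv c \<xi>, w))"
      unfolding case_prod_beta
      by (rule continuous_on_compose2[OF homeomorphism_cont2[OF g]]) (use c in \<open>auto simp: im\<close>)
    show "snd ?b ` fst ?b \<subseteq> snd ?b ` fst ?b" ..
    have inv: "(case snd ?b e of (\<xi>, w) \<Rightarrow> g (chart_inv c \<xi>, w)) = e" if "e \<in> fst ?b" for e
      using that c homeomorphism_apply1[OF g, of e] by (simp add: bundle_chart_def)
    then show "(\<lambda>(\<xi>, w). g (chart_inv c \<xi>, w)) ` (snd ?b ` fst ?b) \<subseteq> fst ?b"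
      by (simp add: image_subset_iff)
    show "(case snd ?b e of (\<xi>, w) \<Rightarrow> g (chart_inv c \<xi>, w)) = e" if "e \<in> fst ?b" for e
      by (rule inv[OF that])
    show "snd ?b (case y of (\<xi>, w) \<Rightarrow> g (chart_inv c \<xi>, w)) = y" if y: "y \<in> snd ?b ` fst ?b" for y
    proof -
      obtain e where "e \<in> fst ?b" "y = snd ?b e" using y by blast
      then show ?thesis using inv by (simp only:)
    qed
  qed
  \<comment> \<open>\<open>is_chart\<close> asks for the particular inverse \<open>inv_into\<close>,
    which agrees on the image with the explicit inverse built from \<open>g\<close>.\<close>
  ultimately show ?thesis
    unfolding is_chart_def by (blast intro: homeomorphism_inv_into)
qed

text \<open>\<open>C1_on\<close> asks for a derivative that is continuous in the operator norm.
  Hence the product rule is written with bounded linear maps that depend continuously on the point: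
  \<open>inl\<close> and \<open>inr\<close> include the two factors, and
  \<open>blinfun.prod_left w\<close> is evaluation at \<open>w\<close>.\<close>

lemma C1_on_bundle_transition:
  fixes \<kappa> :: "'a::real_normed_vector \<Rightarrow> 'b::real_normed_vector"
    and G :: "'a \<Rightarrow> 'c::real_normed_vector \<Rightarrow>\<^sub>L 'd::real_normed_vector"
  assumes "C1_on \<kappa> S" "C1_on G S"
  shows "C1_on (\<lambda>z. (\<kappa> (fst z), blinfun_apply (G (fst z)) (snd z))) (S \<times> UNIV)"
proof -
  obtain k' where k': "\<forall>x\<in>S. (\<kappa> has_derivative blinfun_apply (k' x)) (at x)" "continuous_on S k'"
    using assms(1) unfolding C1_on_def by (elim exE conjE)
  obtain G' where G': "\<forall>x\<in>S. (G has_derivative blinfun_apply (G' x)) (at x)" "continuous_on S G'"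
    using assms(2) unfolding C1_on_def by (elim exE conjE)
  have G: "continuous_on S G"
    using G'(1) has_derivative_continuous continuous_at_imp_continuous_on by blast
  define inl :: "'b \<Rightarrow>\<^sub>L ('b \<times> 'd)" where "inl = Blinfun (\<lambda>b. (b, 0))"
  define inr :: "'d \<Rightarrow>\<^sub>L ('b \<times> 'd)" where "inr = Blinfun (\<lambda>b. (0, b))"
  define D where "D z = (inl o\<^sub>L k' (fst z) o\<^sub>L fst_blinfun)
    + (inr o\<^sub>L ((blinfun.prod_left (snd z) o\<^sub>L G' (fst z) o\<^sub>L fst_blinfun)
      + (G (fst z) o\<^sub>L snd_blinfun)))" for z
  have inl: "blinfun_apply inl = (\<lambda>b. (b, 0))"
    unfolding inl_def by (intro bounded_linear_Blinfun_apply bounded_linear_Pair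
        bounded_linear_ident bounded_linear_zero)
  have inr: "blinfun_apply inr = (\<lambda>b. (0, b))"
    unfolding inr_def by (intro bounded_linear_Blinfun_apply bounded_linear_Pair
        bounded_linear_ident bounded_linear_zero)
  have D: "blinfun_apply (D z) h = (k' (fst z) (fst h), G' (fst z) (fst h) (snd z) + G (fst z) (snd h))"
    for z h
    by (simp add: D_def inl inr blinfun.add_left blinfun.add_right)
  have "((\<lambda>z. (\<kappa> (fst z), blinfun_apply (G (fst z)) (snd z))) has_derivative blinfun_apply (D z)) (at z)"
    if "z \<in> S \<times> UNIV" for z
  proof -
    have S: "fst z \<in> S" using that by auto
    have f: "(fst has_derivative fst) (at z)" by (intro derivative_intros)
    have "((\<lambda>z. \<kappa> (fst z)) has_derivative (\<lambda>h. k' (fst z) (fst h))) (at z)"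
      by (rule has_derivative_compose[OF f bspec[OF k'(1) S]])
    moreover have "((\<lambda>z. G (fst z)) has_derivative (\<lambda>h. G' (fst z) (fst h))) (at z)"
      by (rule has_derivative_compose[OF f bspec[OF G'(1) S]])
    then have "((\<lambda>z. blinfun_apply (G (fst z)) (snd z)) has_derivative
        (\<lambda>h. G (fst z) (snd h) + G' (fst z) (fst h) (snd z))) (at z)"
      by (rule blinfun.FDERIV) (intro derivative_intros)
    ultimately have "((\<lambda>z. (\<kappa> (fst z), blinfun_apply (G (fst z)) (snd z))) has_derivative
        (\<lambda>h. (k' (fst z) (fst h), G (fst z) (snd h) + G' (fst z) (fst h) (snd z)))) (at z)"
      by (rule has_derivative_Pair)
    then show ?thesis by (simp add: D[abs_def] add.commute)
  qed
  moreover have "continuous_on (S \<times> UNIV) D"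
  proof -
    have f: "continuous_on (S \<times> UNIV) (\<lambda>z. fst z)" by (intro continuous_intros)
    have "continuous_on (S \<times> UNIV) (\<lambda>z. k' (fst z))" "continuous_on (S \<times> UNIV) (\<lambda>z. G' (fst z))"
      "continuous_on (S \<times> UNIV) (\<lambda>z. G (fst z))"
      by (rule continuous_on_compose2[OF _ f], rule k' G' G, auto)+
    moreover have "continuous_on (S \<times> UNIV) (\<lambda>z. blinfun.prod_left (snd z))"
      by (intro bounded_linear.continuous_on[OF blinfun.bounded_linear_prod_left] continuous_intros)
    ultimately show ?thesis unfolding D_def by (intro continuous_intros)
  qed
  ultimately show ?thesis unfolding C1_on_def by blast
qed

lemma C1_on_cong:
  assumes "open S" "\<And>x. x \<in> S \<Longrightarrow> f x = g x" "C1_on f S"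
  shows "C1_on g S"
proof -
  obtain f' where f': "\<forall>x\<in>S. (f has_derivative blinfun_apply (f' x)) (at x)" "continuous_on S f'"
    using assms(3) unfolding C1_on_def by (elim exE conjE)
  have "(g has_derivative blinfun_apply (f' x)) (at x)" if "x \<in> S" for x
    using has_derivative_transform_within_open[OF bspec[OF f'(1) that] assms(1) that assms(2)] .
  then show ?thesis using f'(2) unfolding C1_on_def by blast
qed

lemma C1_on_subset:
  assumes "C1_on f S" "T \<subseteq> S"
  shows "C1_on f T"
proof -
  obtain f' where f': "\<forall>x\<in>S. (f has_derivative blinfun_apply (f' x)) (at x)" "continuous_on S f'"
    using assms(1) unfolding C1_on_def by (elim exE conjE)
  then show ?thesis using assms(2) continuous_on_subset[OF f'(2) assms(2)] unfolding C1_on_def by blast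
qed

lemma C1_on_bundle_chart_change:
  fixes AY :: "('y::topological_space, 'b::real_normed_vector) chart set"
    and p :: "'e::topological_space \<Rightarrow> 'y" and TR :: "('y, 'e, 'v::real_normed_vector) triv set"
  assumes E: "C1_vector_bundle AY p TR" and AY: "C1_atlas AY"
    and c: "c \<in> AY" "c' \<in> AY" and s: "s \<in> TR" "s' \<in> TR"
  shows "C1_on (snd (bundle_chart p c' s') \<circ> chart_inv (bundle_chart p c s))
    (snd (bundle_chart p c s) ` (fst (bundle_chart p c s) \<inter> fst (bundle_chart p c' s')))"
proof -
  let ?b = "bundle_chart p c s" and ?b' = "bundle_chart p c' s'"
  define U where "U = fst c \<inter> fst s \<inter> (fst c' \<inter> fst s')"
  have ch: "is_chart c" "is_chart c'" using AY c C1_atlas_is_chart by blast+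
  have op: "open (fst s)" "open (fst s')" using E s unfolding C1_vector_bundle_def by blast+
  have dom: "fst ?b \<inter> fst ?b' = p -` U" by (auto simp: bundle_chart_def U_def)
  have im: "snd ?b ` (fst ?b \<inter> fst ?b') = (snd c ` U) \<times> UNIV"
    unfolding dom by (rule bundle_chart_image[OF E s(1)]) (auto simp: U_def)
  have "U = fst c \<inter> (fst s \<inter> (fst c' \<inter> fst s'))" by (auto simp: U_def)
  then have oU: "open (snd c ` U)"
    using is_chart_image_open[OF ch(1)] op is_chart_open(1)[OF ch(2)] by (simp add: open_Int)
  have \<kappa>: "C1_on (snd c' \<circ> chart_inv c) (snd c ` U)"
    by (rule C1_on_subset[of _ "snd c ` (fst c \<inter> fst c')"])
       (use AY c in \<open>auto simp: C1_atlas_def C1_compatible_def U_def\<close>)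
  have "\<forall>s\<in>TR. \<forall>t\<in>TR. \<forall>c\<in>AY. \<exists>G :: 'b \<Rightarrow> 'v \<Rightarrow>\<^sub>L 'v.
        C1_on G (snd c ` (fst c \<inter> fst s \<inter> fst t)) \<and>
        (\<forall>e. p e \<in> fst c \<inter> fst s \<inter> fst t \<longrightarrow> snd t e = blinfun_apply (G (snd c (p e))) (snd s e))"
    using E unfolding C1_vector_bundle_def by (elim conjE)
  from bspec[OF bspec[OF bspec[OF this s(1)] s(2)] c(1)] obtain G :: "'b \<Rightarrow> 'v \<Rightarrow>\<^sub>L 'v" where
    G: "C1_on G (snd c ` (fst c \<inter> fst s \<inter> fst s'))"
    "\<forall>e. p e \<in> fst c \<inter> fst s \<inter> fst s' \<longrightarrow> snd s' e = blinfun_apply (G (snd c (p e))) (snd s e)"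
    by (elim exE conjE)
  have "C1_on G (snd c ` U)" by (rule C1_on_subset[OF G(1)]) (auto simp: U_def)
  from C1_on_bundle_transition[OF \<kappa> this]
  show ?thesis
    unfolding im
  proof (rule C1_on_cong[rotated 2])
    show "open (snd c ` U \<times> (UNIV :: 'v set))" using oU by (simp add: open_Times)
    fix z :: "'b \<times> 'v" assume "z \<in> snd c ` U \<times> UNIV"
    then obtain e where e: "e \<in> fst ?b \<inter> fst ?b'" "z = snd ?b e" unfolding im[symmetric] by blast
    have "chart_inv ?b z = e"
      using e chart_inv_chart[OF is_chart_bundle_chart[OF E s(1) ch(1)]] by simp
    then show "((snd c' \<circ> chart_inv c) (fst z), blinfun_apply (G (fst z)) (snd z))
        = (snd ?b' \<circ> chart_inv ?b) z"
      using e G(2) ch(1) by (simp add: bundle_chart_def)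
  qed
qed

text \<open>The form of \<open>Q\<close> is given in product charts, whereas the regularity of
  \<open>F\<close> and \<open>F'\<close> refers to the maximal atlas of the total space. Membership
  in that atlas lets both be used in the same chart.\<close>

lemma bundle_chart_in_total_atlas:
  assumes E: "C1_vector_bundle AY p TR" and AY: "C1_atlas AY" and c: "c \<in> AY" and s: "s \<in> TR"
  shows "bundle_chart p c s \<in> total_atlas AY p TR"
  unfolding total_atlas_def maximal_atlas_def mem_Collect_eq
proof (intro conjI ballI)
  show "is_chart (bundle_chart p c s)"
    by (rule is_chart_bundle_chart[OF E s C1_atlas_is_chart[OF AY c]])
  fix d assume "d \<in> {bundle_chart p c s |c s. c \<in> AY \<and> s \<in> TR}"
  then obtain c' s' where d: "d = bundle_chart p c' s'" "c' \<in> AY" "s' \<in> TR" by blast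
  show "C1_compatible (bundle_chart p c s) d"
    unfolding C1_compatible_def d(1)
  proof
    show "C1_on (snd (bundle_chart p c' s') \<circ> chart_inv (bundle_chart p c s))
      (snd (bundle_chart p c s) ` (fst (bundle_chart p c s) \<inter> fst (bundle_chart p c' s')))"
      by (rule C1_on_bundle_chart_change[OF E AY c d(2) s d(3)])
    show "C1_on (snd (bundle_chart p c s) \<circ> chart_inv (bundle_chart p c' s'))
      (snd (bundle_chart p c' s') ` (fst (bundle_chart p c s) \<inter> fst (bundle_chart p c' s')))"
      using C1_on_bundle_chart_change[OF E AY d(2) c d(3) s] by (simp only: Int_commute)
  qed
qed

section \<open>Retractions in charts\<close>

text \<open>A retraction may be C1 with respect to different charts of source and target. As the
  zero vector at \<open>z\<close> is sent to \<open>z\<close>, the target chart can be exchanged for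
  \<open>c\<close> nearby. The derivative is linear, hence determined by two restrictions: along the
  zero section the map is the identity, and on the fibre over \<open>z\<close> its derivative at 0
  is the identity.\<close>

lemma retraction_chart_derivative:
  assumes A: "C1_atlas A" and R: "C1_retraction A R"
  obtains c V where "c \<in> A" "z \<in> fst c" "open V" "(snd c z, 0) \<in> V"
    "\<And>\<xi> w. (\<xi>, w) \<in> V \<Longrightarrow> R (chart_inv c \<xi>) (tangent_of A (chart_inv c \<xi>) c w) \<in> fst c"
    "((\<lambda>(\<xi>, w). snd c (R (chart_inv c \<xi>) (tangent_of A (chart_inv c \<xi>) c w)))
      has_derivative (\<lambda>(a, b). a + b)) (at (snd c z, 0))"
proof -
  have R0: "R x (\<lambda>_. 0) = x" for x using R unfolding C1_retraction_def by blast
  have "\<forall>x. \<forall>v\<in>tangent_space A x. \<exists>c\<in>A. \<exists>d\<in>A. x \<in> fst c \<and> R x v \<in> fst d \<and>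
        (\<exists>S. open S \<and> (snd c x, v c) \<in> S \<and> S \<subseteq> snd c ` fst c \<times> UNIV \<and>
           (\<forall>(\<xi>, w)\<in>S. R (chart_inv c \<xi>) (tangent_of A (chart_inv c \<xi>) c w) \<in> fst d) \<and>
           C1_on (\<lambda>(\<xi>, w). snd d (R (chart_inv c \<xi>) (tangent_of A (chart_inv c \<xi>) c w))) S)"
    using R unfolding C1_retraction_def by (elim conjE)
  from bspec[OF spec[OF this] zero_in_tangent_space[OF A, of z]]
  obtain c d S where c: "c \<in> A" "z \<in> fst c" and d: "d \<in> A" "R z (\<lambda>_. 0) \<in> fst d"
    and S: "open S" "(snd c z, 0) \<in> S" "S \<subseteq> snd c ` fst c \<times> UNIV"
      "\<forall>(\<xi>, w)\<in>S. R (chart_inv c \<xi>) (tangent_of A (chart_inv c \<xi>) c w) \<in> fst d"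
      "C1_on (\<lambda>(\<xi>, w). snd d (R (chart_inv c \<xi>) (tangent_of A (chart_inv c \<xi>) c w))) S"
    by (elim bexE exE conjE)
  define y where "y z = R (chart_inv c (fst z)) (tangent_of A (chart_inv c (fst z)) c (snd z))" for z
  have S': "y z \<in> fst d" if "z \<in> S" for z using S(4) that by (auto simp: y_def)
  have "C1_on (\<lambda>z. snd d (y z)) S" using S(5) by (simp add: y_def case_prod_unfold)
  then obtain r' where r': "\<forall>z\<in>S. ((\<lambda>z. snd d (y z)) has_derivative blinfun_apply (r' z)) (at z)"
    unfolding C1_on_def by (elim exE conjE)
  have ch: "is_chart c" "is_chart d" using A c(1) d(1) C1_atlas_is_chart by blast+
  have zd: "z \<in> fst d" using d(2) R0 by simp
  have y0: "y (\<xi>, 0) = chart_inv c \<xi>" if "\<xi> \<in> snd c ` fst c" for \<xi>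
    using tangent_of_zero[OF A c(1) chart_inv_into[OF that]] R0 by (simp add: y_def)
  have yz: "y (snd c z, 0) = z" using y0[of "snd c z"] c(2) ch(1) by simp
  \<comment> \<open>On \<open>S\<close> the values are known to lie in \<open>d\<close>; the smaller
    set \<open>V\<close> keeps them in \<open>c\<close> too.\<close>
  define V where "V = S \<inter> (\<lambda>z. snd d (y z)) -` (snd d ` (fst d \<inter> fst c))"
  have "continuous_on S (\<lambda>z. snd d (y z))"
    using r' by (auto intro!: continuous_at_imp_continuous_on has_derivative_continuous)
  then have oV: "open V"
    unfolding V_def using S(1) is_chart_image_open[OF ch(2) is_chart_open(1)[OF ch(1)]]
    by (rule continuous_open_preimage)
  have zV: "(snd c z, 0) \<in> V" using S(2) yz zd c(2) by (auto simp: V_def)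
  have yV: "y u \<in> fst c" "y u \<in> fst d" if u: "u \<in> V" for u
  proof -
    obtain x where x: "x \<in> fst d" "x \<in> fst c" "snd d (y u) = snd d x" using u by (auto simp: V_def)
    show d: "y u \<in> fst d" using S' u by (simp add: V_def)
    show "y u \<in> fst c" unfolding chart_eqD[OF ch(2) d x(1,3)] by (rule x(2))
  qed
  have "((snd c \<circ> chart_inv d) has_derivative change_deriv d c z) (at (snd d (y (snd c z, 0))))"
    using change_has_derivative[OF A d(1) c(1) zd c(2)] yz by simp
  from has_derivative_compose[OF bspec[OF r' S(2)] this]
  have "((\<lambda>u. snd c (y u)) has_derivative
      (\<lambda>h. change_deriv d c z (blinfun_apply (r' (snd c z, 0)) h))) (at (snd c z, 0))"
    by (rule has_derivative_transform_within_open[OF _ oV zV]) (use yV ch(2) in simp)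
  then obtain D where D: "((\<lambda>u. snd c (y u)) has_derivative D) (at (snd c z, 0))" by blast
  have "((\<lambda>\<xi>. (\<xi>, 0)) has_derivative (\<lambda>a. (a, 0))) (at (snd c z))"
    by (intro derivative_intros)
  from has_derivative_compose[OF this D]
  have "((\<lambda>\<xi>. snd c (y (\<xi>, 0))) has_derivative (\<lambda>a. D (a, 0))) (at (snd c z))" .
  moreover have "((\<lambda>\<xi>. snd c (y (\<xi>, 0))) has_derivative (\<lambda>a. a)) (at (snd c z))"
    by (rule has_derivative_transform_within_open[OF has_derivative_ident is_chart_open(2)[OF ch(1)]])
       (use c(2) y0 in \<open>simp_all add: chart_chart_inv\<close>)
  ultimately have D1: "(\<lambda>a. D (a, 0)) = (\<lambda>a. a)" by (rule has_derivative_unique)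
  have "((\<lambda>w. (snd c z, w)) has_derivative (\<lambda>b. (0, b))) (at 0)"
    by (intro derivative_intros)
  from has_derivative_compose[OF this D]
  have "((\<lambda>w. snd c (y (snd c z, w))) has_derivative (\<lambda>b. D (0, b))) (at 0)" .
  moreover have "\<forall>x. \<forall>c\<in>A. x \<in> fst c \<longrightarrow>
        ((\<lambda>w. snd c (R x (tangent_of A x c w))) has_derivative (\<lambda>w. w)) (at 0)"
    using R unfolding C1_retraction_def by (elim conjE)
  then have "((\<lambda>w. snd c (R z (tangent_of A z c w))) has_derivative (\<lambda>w. w)) (at 0)"
    using c by simp
  then have "((\<lambda>w. snd c (y (snd c z, w))) has_derivative (\<lambda>w. w)) (at 0)"
    using c(2) ch(1) by (simp add: y_def)
  ultimately have D2: "(\<lambda>b. D (0, b)) = (\<lambda>b. b)" by (rule has_derivative_unique)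
  have "D (a, b) = a + b" for a b
  proof -
    have "D (a, b) = D ((a, 0) + (0, b))" by simp
    also have "\<dots> = D (a, 0) + D (0, b)" by (rule linear_add[OF has_derivative_linear[OF D]])
    finally show ?thesis using fun_cong[OF D1, of a] fun_cong[OF D2, of b] by simp
  qed
  then have D_eq: "D = (\<lambda>(a, b). a + b)" by auto
  have y_eq: "(\<lambda>u. snd c (y u)) =
      (\<lambda>(\<xi>, w). snd c (R (chart_inv c \<xi>) (tangent_of A (chart_inv c \<xi>) c w)))"
    by (auto simp: y_def)
  show ?thesis
  proof (rule that[OF c oV zV _ D[unfolded D_eq y_eq]])
    fix \<xi> w assume "(\<xi>, w) \<in> V"
    from yV(1)[OF this] show "R (chart_inv c \<xi>) (tangent_of A (chart_inv c \<xi>) c w) \<in> fst c"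
      by (simp add: y_def)
  qed
qed

lemma retraction_chart_expansion:
  assumes A: "C1_atlas A" and R: "C1_retraction A R"
  obtains c where "c \<in> A" "z \<in> fst c"
    "\<And>\<epsilon>. \<epsilon> > 0 \<Longrightarrow> \<exists>\<eta>>0. \<forall>x\<in>fst c. \<forall>v\<in>tangent_space A x.
      norm (snd c x - snd c z) < \<eta> \<longrightarrow> norm (v c) < \<eta> \<longrightarrow> R x v \<in> fst c \<and>
      norm (snd c (R x v) - snd c z - (snd c x - snd c z + v c))
        \<le> \<epsilon> * (norm (snd c x - snd c z) + norm (v c))"
proof (rule retraction_chart_derivative[OF A R, of z])
  fix c V assume c: "c \<in> A" "z \<in> fst c" and V: "open V" "(snd c z, 0) \<in> V"
    and RV: "\<And>\<xi> w. (\<xi>, w) \<in> V \<Longrightarrow> R (chart_inv c \<xi>) (tangent_of A (chart_inv c \<xi>) c w) \<in> fst c"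
    and D: "((\<lambda>(\<xi>, w). snd c (R (chart_inv c \<xi>) (tangent_of A (chart_inv c \<xi>) c w)))
      has_derivative (\<lambda>(a, b). a + b)) (at (snd c z, 0))"
  have ch: "is_chart c" using A c(1) by (rule C1_atlas_is_chart)
  have Rz: "R z (tangent_of A z c 0) = z"
    using R tangent_of_zero[OF A c] unfolding C1_retraction_def by simp
  show thesis
  proof (rule that[OF c])
    fix \<epsilon> :: real assume "\<epsilon> > 0"
    then obtain \<delta> where \<delta>: "\<delta> > 0" "\<And>u. norm (u - (snd c z, 0)) < \<delta> \<Longrightarrow>
      norm ((case u of (\<xi>, w) \<Rightarrow> snd c (R (chart_inv c \<xi>) (tangent_of A (chart_inv c \<xi>) c w)))
        - (case (snd c z, 0) of (\<xi>, w) \<Rightarrow> snd c (R (chart_inv c \<xi>) (tangent_of A (chart_inv c \<xi>) c w)))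
        - (case u - (snd c z, 0) of (a, b) \<Rightarrow> a + b)) \<le> \<epsilon> * norm (u - (snd c z, 0))"
      using D[unfolded has_derivative_at_alt] by blast
    obtain \<rho> where \<rho>: "\<rho> > 0" "ball (snd c z, 0) \<rho> \<subseteq> V" using V open_contains_ball by blast
    \<comment> \<open>The norm of a pair is at most the sum of the norms, so half of
      \<open>min \<rho> \<delta>\<close> for each component keeps the pair within both
      radii.\<close>
    show "\<exists>\<eta>>0. \<forall>x\<in>fst c. \<forall>v\<in>tangent_space A x.
      norm (snd c x - snd c z) < \<eta> \<longrightarrow> norm (v c) < \<eta> \<longrightarrow> R x v \<in> fst c \<and>
      norm (snd c (R x v) - snd c z - (snd c x - snd c z + v c))
        \<le> \<epsilon> * (norm (snd c x - snd c z) + norm (v c))"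
    proof (intro exI[of _ "min \<rho> \<delta> / 2"] conjI ballI impI)
      show "0 < min \<rho> \<delta> / 2" using \<rho>(1) \<delta>(1) by simp
      fix x v assume x: "x \<in> fst c" and v: "v \<in> tangent_space A x"
        and small: "norm (snd c x - snd c z) < min \<rho> \<delta> / 2" "norm (v c) < min \<rho> \<delta> / 2"
      have xv: "chart_inv c (snd c x) = x" "tangent_of A x c (v c) = v"
        using ch x tangent_space_eq_tangent_of[OF A c(1) x v] by simp_all
      have le: "norm ((snd c x, v c) - (snd c z, 0)) \<le> norm (snd c x - snd c z) + norm (v c)"
        using norm_Pair_le[of "snd c x - snd c z" "v c"] by simp
      then have lt: "norm ((snd c x, v c) - (snd c z, 0)) < min \<rho> \<delta>" using small by linarith
      then have "dist (snd c x, v c) (snd c z, 0) < \<rho>" unfolding dist_norm by linarith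
      then have "(snd c x, v c) \<in> ball (snd c z, 0) \<rho>" by (simp add: dist_commute)
      then show "R x v \<in> fst c" using RV[of "snd c x" "v c"] \<rho>(2) xv by auto
      have "norm (snd c (R x v) - snd c z - (snd c x - snd c z + v c))
          \<le> \<epsilon> * norm ((snd c x, v c) - (snd c z, 0))"
        using \<delta>(2)[of "(snd c x, v c)"] lt xv ch c(2) Rz by simp
      also have "\<dots> \<le> \<epsilon> * (norm (snd c x - snd c z) + norm (v c))"
        using le \<open>\<epsilon> > 0\<close> by (intro mult_left_mono) auto
      finally show "norm (snd c (R x v) - snd c z - (snd c x - snd c z + v c))
        \<le> \<epsilon> * (norm (snd c x - snd c z) + norm (v c))" .
    qed
  qed
qed

section \<open>Newton steps\<close>

text \<open>Surjectivity of the operator is applied to the negative of \<open>F x\<close>, an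
  element of the fibre that is found through a trivialization.\<close>

lemma newton_step_exists:
  assumes E: "C1_vector_bundle AY p TR" and AY: "C1_atlas AY"
    and bij: "bij_betw (\<lambda>v. Q (F x) (F' x v)) (tangent_space A x) (p -` {p (F x)})"
  obtains v where "v \<in> tangent_space A x"
    "fibre_add p TR (Q (F x) (F' x v)) (F x) = fibre_zero p TR (p (F x))"
proof -
  have "\<forall>y. \<exists>s\<in>TR. y \<in> fst s" using E unfolding C1_vector_bundle_def by (elim conjE)
  then obtain s where s: "s \<in> TR" "p (F x) \<in> fst s" by blast
  obtain e where e: "p e = p (F x)" "snd s e = - snd s (F x)"
    using bundle_fibre_onto[OF E s, of "- snd s (F x)"] by blast
  have "e \<in> (\<lambda>v. Q (F x) (F' x v)) ` tangent_space A x"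
    unfolding bij_betw_imp_surj_on[OF bij] using e(1) by simp
  then obtain v where v: "v \<in> tangent_space A x" "e = Q (F x) (F' x v)" by blast
  have se: "p e \<in> fst s" using e s by simp
  note z = fibre_zero_triv[OF E AY s] and a = fibre_add_triv[OF E AY s(1) se e(1)[symmetric]]
  have "fibre_add p TR e (F x) = fibre_zero p TR (p (F x))"
    by (rule bundle_fibre_inj[OF E s(1)]) (use a z e s in simp_all)
  then show ?thesis using v by (intro that[of v]) simp_all
qed

text \<open>Turns a bound on a unit ball into a linear estimate: \<open>n\<close> is the size of a
  vector, \<phi> that of its image, and \<open>K\<close> and \<open>m\<close> come from equivalences
  of norms. For \<phi> > 0, scaling by \<open>1 / (K * \<phi>)\<close> exhausts the
  constraint.\<close>

lemma bound_from_scaling: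
  fixes K m n \<phi> \<beta> :: real
  assumes "K > 0" "m > 0" "\<phi> \<ge> 0" "n \<ge> 0"
    and scale: "\<And>r. r \<ge> 0 \<Longrightarrow> K * (r * \<phi>) \<le> 1 \<Longrightarrow> m * (r * n) \<le> \<beta>"
  shows "n \<le> \<bar>\<beta>\<bar> * K / m * \<phi>"
proof (cases "\<phi> = 0")
  case True
  have "n = 0"
  proof (rule ccontr)
    assume "n \<noteq> 0"
    then have n: "n > 0" using \<open>n \<ge> 0\<close> by simp
    \<comment> \<open>For \<phi> = 0 every nonnegative scaling is admissible; this one makes the
      left side equal to \<open>\<bar>\<beta>\<bar> + 1\<close>, which exceeds \<beta>.\<close>
    have "m * ((\<bar>\<beta>\<bar> + 1) / (m * n) * n) \<le> \<beta>"
      by (rule scale) (use True n \<open>m > 0\<close> in auto)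
    then show False using n \<open>m > 0\<close> by simp
  qed
  then show ?thesis using True by simp
next
  case False
  then have \<phi>: "\<phi> > 0" using assms by simp
  have "m * (1 / (K * \<phi>) * n) \<le> \<beta>"
    by (rule scale) (use \<phi> \<open>K > 0\<close> in auto)
  then have "m * (1 / (K * \<phi>) * n) \<le> \<bar>\<beta>\<bar>" by linarith
  then show ?thesis using \<phi> assms(1,2) by (simp add: field_simps)
qed

lemma newton_step_estimate:
  fixes AX :: "('x::t2_space, 'a::real_normed_vector) chart set"
    and AY :: "('y::topological_space, 'b::real_normed_vector) chart set"
    and p :: "'e::topological_space \<Rightarrow> 'y"
    and TR :: "('y, 'e, 'v::real_normed_vector) triv set"
    and Q :: "'e \<Rightarrow> ('e, 'b \<times> 'v) tvec \<Rightarrow> 'e"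
  assumes AX: "C1_atlas AX" and AY: "C1_atlas AY" and E: "C1_vector_bundle AY p TR"
    and NX: "continuous_norm (tangent_bundle AX) fst (tangent_trivs AX) NX"
    and NE: "continuous_norm UNIV p TR NE"
    and Q: "linear_continuous_connection_map AY p TR Q"
    and lip: "locally_lipschitz_in_charts AX (total_atlas AY p TR) F"
    and sec: "hom_section AX (total_atlas AY p TR) F F'"
    and bnd: "locally_bounded_in_charts AX (total_atlas AY p TR) F F'"
    and newton: "newton_differentiable_at AX (total_atlas AY p TR) F F' z"
    and zero: "F z = fibre_zero p TR (p (F z))"
    and bij: "\<And>x. bij_betw (\<lambda>v. Q (F x) (F' x v)) (tangent_space AX x) (p -` {p (F x)})"
    and inv: "\<And>x. operator_norm (p -` {p (F x)}) NE (\<lambda>v. NX (x, v))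
               (inv_into (tangent_space AX x) (\<lambda>v. Q (F x) (F' x v))) \<le> ereal \<beta>"
    and c: "c \<in> AX" "z \<in> fst c" and \<epsilon>: "\<epsilon> > 0"
  shows "\<exists>\<eta>>0. \<forall>x\<in>fst c. \<forall>v\<in>tangent_space AX x. norm (snd c x - snd c z) < \<eta> \<longrightarrow>
    fibre_add p TR (Q (F x) (F' x v)) (F x) = fibre_zero p TR (p (F x)) \<longrightarrow>
    norm (v c + (snd c x - snd c z)) \<le> \<epsilon> * norm (snd c x - snd c z)"
proof -
  have ch: "is_chart c" using AX c(1) by (rule C1_atlas_is_chart)
  have "\<forall>y. \<exists>s\<in>TR. y \<in> fst s" using E unfolding C1_vector_bundle_def by (elim conjE)
  then obtain s where s: "s \<in> TR" "p (F z) \<in> fst s" by blast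
  obtain c1 where c1: "c1 \<in> AY" "p (F z) \<in> fst c1" using AY unfolding C1_atlas_def by blast
  have ch1: "is_chart c1" using AY c1(1) by (rule C1_atlas_is_chart)
  define d where "d = bundle_chart p c1 s"
  have d: "d \<in> total_atlas AY p TR" unfolding d_def by (rule bundle_chart_in_total_atlas[OF E AY c1(1) s(1)])
  have d_dom: "e \<in> fst d \<longleftrightarrow> p e \<in> fst c1 \<inter> fst s" and d_app: "snd d e = (snd c1 (p e), snd s e)" for e
    by (simp_all add: d_def bundle_chart_def)
  have zd: "F z \<in> fst d" using s c1 by (simp add: d_dom)
  define f where "f = map_rep c d F"
  have f_app: "f (snd c x) = (snd c1 (p (F x)), snd s (F x))" if "x \<in> fst c" for x
    using that ch by (simp add: f_def map_rep_def d_app)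
  \<comment> \<open>Only the fibre component of \<open>f\<close> vanishes at \<open>z\<close>; the
    base component is the coordinate of \<open>p (F z)\<close>, on which nothing is imposed.\<close>
  have fz: "snd (f (snd c z)) = 0"
    using f_app[OF c(2)] fibre_zero_triv(2)[OF E AY s] zero by simp
  obtain S1 L where S1: "open S1" "snd c z \<in> S1" "S1 \<subseteq> snd c ` (fst c \<inter> F -` fst d)"
    and "L-lipschitz_on S1 f"
    using lip d zd c unfolding locally_lipschitz_in_charts_def f_def by meson
  then have f_cont: "continuous_on S1 f" using lipschitz_on_continuous_on by blast
  obtain S2 K0 where S2: "open S2" "snd c z \<in> S2"
    and K0: "\<forall>\<xi>\<in>S2. onorm (section_rep AX c d F' \<xi>) \<le> K0"
    using bnd d zd c unfolding locally_bounded_in_charts_def by meson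
  define K where "K = \<bar>K0\<bar> + 1"
  have K: "K > 0" "K0 \<le> K" by (simp_all add: K_def)
  have Q1: "p (Q e v) = p e" if "v \<in> tangent_space (total_atlas AY p TR) e" for e v
    using Q that unfolding linear_continuous_connection_map_def connection_map_def by simp
  have "\<forall>c\<in>AY. \<forall>s\<in>TR. \<exists>B :: 'y \<Rightarrow> 'v \<Rightarrow> 'b \<Rightarrow>\<^sub>L 'v.
        (\<forall>e. p e \<in> fst c \<inter> fst s \<longrightarrow> (\<forall>v\<in>tangent_space (total_atlas AY p TR) e.
           snd s (Q e v) = snd (v (bundle_chart p c s))
             - blinfun_apply (B (p e) (snd s e)) (fst (v (bundle_chart p c s))))) \<and>
        (\<forall>y\<in>fst c \<inter> fst s. linear (B y)) \<and>
        continuous_on ((fst c \<inter> fst s) \<times> UNIV) (\<lambda>(y, w). B y w)"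
    using Q unfolding linear_continuous_connection_map_def by (elim conjE)
  from bspec[OF bspec[OF this c1(1)] s(1)]
  obtain B :: "'y \<Rightarrow> 'v \<Rightarrow> 'b \<Rightarrow>\<^sub>L 'v" where
    B0: "\<forall>e. p e \<in> fst c1 \<inter> fst s \<longrightarrow> (\<forall>v\<in>tangent_space (total_atlas AY p TR) e.
        snd s (Q e v) = snd (v (bundle_chart p c1 s))
          - blinfun_apply (B (p e) (snd s e)) (fst (v (bundle_chart p c1 s))))"
    and B_lin: "\<forall>y\<in>fst c1 \<inter> fst s. linear (B y)"
    and B_cont: "continuous_on ((fst c1 \<inter> fst s) \<times> UNIV) (\<lambda>(y, w). B y w)"
    by (elim exE conjE)
  have B: "snd s (Q e v) = snd (v d) - blinfun_apply (B (p e) (snd s e)) (fst (v d))"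
    if "p e \<in> fst c1 \<inter> fst s" "v \<in> tangent_space (total_atlas AY p TR) e" for e v
    using B0 that by (simp add: d_def)
  have F_dom: "F (chart_inv c \<xi>) \<in> fst d" "chart_inv c \<xi> \<in> fst c" "snd c (chart_inv c \<xi>) = \<xi>"
    if \<xi>: "\<xi> \<in> S1" for \<xi>
  proof -
    obtain x where "x \<in> fst c" "F x \<in> fst d" "\<xi> = snd c x" using \<xi> S1(3) by blast
    then show "F (chart_inv c \<xi>) \<in> fst d" "chart_inv c \<xi> \<in> fst c" "snd c (chart_inv c \<xi>) = \<xi>"
      using ch by simp_all
  qed
  \<comment> \<open>The base point below \<open>F x\<close> as a function of the coordinate of
    \<open>x\<close>. Expressed through \<open>f\<close> it is continuous, as required for the first
    argument of \<open>B\<close>.\<close>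
  define \<pi> where "\<pi> \<xi> = p (F (chart_inv c \<xi>))" for \<xi>
  have \<pi>_eq: "\<pi> \<xi> = chart_inv c1 (fst (f \<xi>))" "fst (f \<xi>) \<in> snd c1 ` fst c1" "\<pi> \<xi> \<in> fst c1 \<inter> fst s"
    if "\<xi> \<in> S1" for \<xi>
  proof -
    have "f \<xi> = (snd c1 (\<pi> \<xi>), snd s (F (chart_inv c \<xi>)))"
      using f_app[OF F_dom(2)[OF that]] F_dom(3)[OF that] by (simp add: \<pi>_def)
    moreover show "\<pi> \<xi> \<in> fst c1 \<inter> fst s" using F_dom(1)[OF that] by (simp only: d_dom \<pi>_def)
    ultimately show "\<pi> \<xi> = chart_inv c1 (fst (f \<xi>))" "fst (f \<xi>) \<in> snd c1 ` fst c1"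
      using ch1 by simp_all
  qed
  have "continuous_on S1 (\<lambda>\<xi>. chart_inv c1 (fst (f \<xi>)))"
    by (rule continuous_on_compose2[OF is_chart_inv_continuous[OF ch1] continuous_on_fst[OF f_cont]])
       (use \<pi>_eq(2) in blast)
  then have \<pi>_cont: "continuous_on S1 \<pi>"
    by (rule continuous_on_eq) (simp add: \<pi>_eq(1))
  \<comment> \<open>The coefficient of the connection along \<open>F\<close>: it is continuous, and
    it is 0 at \<open>z\<close> because \<open>B\<close> is linear in the fibre variable.\<close>
  define b where "b \<xi> = B (\<pi> \<xi>) (snd (f \<xi>))" for \<xi>
  have "continuous_on S1 (\<lambda>\<xi>. case (\<pi> \<xi>, snd (f \<xi>)) of (y, w) \<Rightarrow> B y w)"
    by (rule continuous_on_compose2[OF B_cont continuous_on_Pair[OF \<pi>_cont continuous_on_snd[OF f_cont]]])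
       (use \<pi>_eq(3) in auto)
  then have b_cont: "continuous_on S1 b" by (simp add: b_def[abs_def])
  have bz: "b (snd c z) = 0"
    using fz linear_0[OF bspec[OF B_lin \<pi>_eq(3)[OF S1(2)]]] by (simp add: b_def)
  obtain UE mE KE where "open UE" "p (F z) \<in> UE" "UE \<subseteq> fst s" "mE > 0" "KE > 0"
    "\<And>e. e \<in> UNIV \<Longrightarrow> p e \<in> UE \<Longrightarrow> (mE :: real) * norm (snd s e) \<le> NE e"
    "\<And>e. e \<in> UNIV \<Longrightarrow> p e \<in> UE \<Longrightarrow> NE e \<le> KE * norm (snd s e)"
    by (rule continuous_norm_locally_equivalent[OF NE s bundle_fibre_onto[OF E s(1)]])
       (assumption, rule that, assumption+)
  then have UE: "open UE" "p (F z) \<in> UE" "KE > 0" "\<And>e. p e \<in> UE \<Longrightarrow> NE e \<le> KE * norm (snd s e)"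
    by simp_all
  obtain UX m where UX: "open UX" "z \<in> UX" "m > 0"
    "\<And>x v. x \<in> UX \<Longrightarrow> v \<in> tangent_space AX x \<Longrightarrow> m * norm (v c) \<le> NX (x, v)"
    by (rule tangent_norm_locally_equivalent[OF AX NX c]) (rule that, simp_all)
  \<comment> \<open>Bounds the inverse of the operator in model norms: \<open>KE\<close> and
    \<open>m\<close> compare these with the norms on the bundle and on the tangent bundle. The
    summand 1 makes \<open>C\<close> positive even for \<beta> = 0.\<close>
  define C where "C = \<bar>\<beta>\<bar> * KE / m + 1"
  have C: "C > 0" using UE(3) UX(3) by (simp add: C_def add_nonneg_pos)
  \<comment> \<open>\<epsilon>1 pays for the connection term, which is at most
    \<open>\<epsilon>1 * K * norm h\<close>, and \<epsilon>2 for the Newton remainder; after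
    multiplication by \<open>C\<close> each takes half of \<epsilon>.\<close>
  define \<epsilon>1 where "\<epsilon>1 = \<epsilon> / (2 * C * K)"
  define \<epsilon>2 where "\<epsilon>2 = \<epsilon> / (2 * C)"
  have eps: "\<epsilon>1 > 0" "\<epsilon>2 > 0" "C * (\<epsilon>2 + \<epsilon>1 * K) = \<epsilon>"
    using \<epsilon> C K by (simp_all add: \<epsilon>1_def \<epsilon>2_def field_simps)
  have "open (S1 \<inter> \<pi> -` UE)" by (rule continuous_open_preimage[OF \<pi>_cont S1(1) UE(1)])
  moreover have "open (S1 \<inter> b -` ball 0 \<epsilon>1)" by (rule continuous_open_preimage[OF b_cont S1(1) open_ball])
  moreover have "open (snd c ` (fst c \<inter> UX))" by (rule is_chart_image_open[OF ch UX(1)])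
  ultimately have "open (S1 \<inter> \<pi> -` UE \<inter> (S1 \<inter> b -` ball 0 \<epsilon>1) \<inter> snd c ` (fst c \<inter> UX) \<inter> S2)"
    using S2(1) by (blast intro: open_Int)
  moreover have "snd c z \<in> S1 \<inter> \<pi> -` UE \<inter> (S1 \<inter> b -` ball 0 \<epsilon>1) \<inter> snd c ` (fst c \<inter> UX) \<inter> S2"
    using S1(2) S2(2) UE(2) UX(2) c(2) ch bz eps(1) by (simp add: \<pi>_def)
  ultimately obtain \<eta>1 where \<eta>1: "\<eta>1 > 0" and
    "ball (snd c z) \<eta>1 \<subseteq> S1 \<inter> \<pi> -` UE \<inter> (S1 \<inter> b -` ball 0 \<epsilon>1) \<inter> snd c ` (fst c \<inter> UX) \<inter> S2"
    using open_contains_ball by blast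
  then have near: "\<xi> \<in> S1" "\<pi> \<xi> \<in> UE" "norm (b \<xi>) < \<epsilon>1" "\<xi> \<in> snd c ` (fst c \<inter> UX)" "\<xi> \<in> S2"
    if "norm (\<xi> - snd c z) < \<eta>1" for \<xi>
    using that by (auto simp: dist_norm norm_minus_commute subset_iff)
  have "((\<lambda>\<xi>. norm (section_rep AX c d F' \<xi> (\<xi> - snd c z) - (f \<xi> - f (snd c z))) / norm (\<xi> - snd c z))
      \<longlongrightarrow> 0) (at (snd c z))"
    using newton c d zd unfolding newton_differentiable_at_def f_def by simp
  from tendstoD[OF this eps(2)] obtain \<eta>2 where \<eta>2: "\<eta>2 > 0"
    "\<forall>\<xi>. \<xi> \<noteq> snd c z \<and> dist \<xi> (snd c z) < \<eta>2 \<longrightarrow>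
      dist (norm (section_rep AX c d F' \<xi> (\<xi> - snd c z) - (f \<xi> - f (snd c z))) / norm (\<xi> - snd c z)) 0 < \<epsilon>2"
    unfolding eventually_at by blast
  have Newton: "norm (section_rep AX c d F' \<xi> (\<xi> - snd c z) - (f \<xi> - f (snd c z))) \<le> \<epsilon>2 * norm (\<xi> - snd c z)"
    if "norm (\<xi> - snd c z) < \<eta>2" "\<xi> \<noteq> snd c z" for \<xi>
  proof -
    have "norm (section_rep AX c d F' \<xi> (\<xi> - snd c z) - (f \<xi> - f (snd c z))) / norm (\<xi> - snd c z) < \<epsilon>2"
      using \<eta>2(2) that by (simp add: dist_norm)
    then show ?thesis using that(2) by (simp add: pos_divide_less_eq less_imp_le)
  qed
  show ?thesis
  proof (intro exI[of _ "min \<eta>1 \<eta>2"] conjI ballI impI)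
    show "0 < min \<eta>1 \<eta>2" using \<eta>1 \<eta>2 by simp
    fix x v assume x: "x \<in> fst c" and v: "v \<in> tangent_space AX x"
      and small: "norm (snd c x - snd c z) < min \<eta>1 \<eta>2"
      and step: "fibre_add p TR (Q (F x) (F' x v)) (F x) = fibre_zero p TR (p (F x))"
    define \<xi> where "\<xi> = snd c x"
    define h where "h = \<xi> - snd c z"
    define T where "T = section_rep AX c d F' \<xi>"
    \<comment> \<open>The operator of the Newton equation at \<open>x\<close> in the chart
      \<open>c\<close> and the trivialization \<open>s\<close>.\<close>
    define \<Phi> where "\<Phi> w = snd (T w) - blinfun_apply (b \<xi>) (fst (T w))" for w
    have \<xi>: "\<xi> \<in> S1" "\<pi> \<xi> \<in> UE" "norm (b \<xi>) < \<epsilon>1" "\<xi> \<in> snd c ` (fst c \<inter> UX)" "\<xi> \<in> S2"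
      using near[of \<xi>] small by (simp_all add: \<xi>_def)
    have x\<xi>: "chart_inv c \<xi> = x" using ch x by (simp add: \<xi>_def)
    have xd: "F x \<in> fst d" using F_dom(1)[OF \<xi>(1)] x\<xi> by simp
    have xs: "p (F x) \<in> fst c1 \<inter> fst s" using xd by (simp only: d_dom)
    have xUX: "x \<in> UX"
    proof -
      obtain x' where x': "x' \<in> fst c" "x' \<in> UX" "\<xi> = snd c x'" using \<xi>(4) by blast
      show ?thesis using chart_eqD[OF ch x x'(1)] x'(2,3) by (simp add: \<xi>_def)
    qed
    have T: "bounded_linear T"
      using sec c(1) d x xd unfolding hom_section_def T_def \<xi>_def by simp
    have F'_tan: "F' x u \<in> tangent_space (total_atlas AY p TR) (F x)" if "u \<in> tangent_space AX x" for u
      using sec that unfolding hom_section_def by blast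
    have Q_p: "p (Q (F x) (F' x u)) = p (F x)" if "u \<in> tangent_space AX x" for u
      by (rule Q1[OF F'_tan[OF that]])
    have b_eq: "b \<xi> = B (p (F x)) (snd s (F x))" using f_app[OF x] x\<xi> by (simp add: b_def \<pi>_def \<xi>_def)
    have Q_s: "snd s (Q (F x) (F' x u)) = \<Phi> (u c)" if u: "u \<in> tangent_space AX x" for u
    proof -
      have "T (u c) = F' x u d"
        using tangent_space_eq_tangent_of[OF AX c(1) x u] x\<xi> by (simp add: T_def section_rep_def)
      then show ?thesis using B[OF xs F'_tan[OF u]] by (simp add: \<Phi>_def b_eq)
    qed
    have \<Phi>_add: "\<Phi> (w + w') = \<Phi> w + \<Phi> w'" for w w'
      by (simp add: \<Phi>_def linear_add[OF bounded_linear.linear[OF T]] blinfun.add_right)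
    have \<Phi>_scale: "\<Phi> (r *\<^sub>R w) = r *\<^sub>R \<Phi> w" for r w
      by (simp add: \<Phi>_def linear_scale[OF bounded_linear.linear[OF T]] blinfun.scaleR_right scaleR_right_diff_distrib)
    have inverse_bound: "norm u \<le> C * norm (\<Phi> u)" for u
    proof -
      \<comment> \<open>The operator norm is a supremum over elements of norm at most 1. For
        admissible \<open>r\<close> the image \<open>e\<close> of the scaled vector is such an
        element, and the inverse returns that vector.\<close>
      have "m * (r * norm u) \<le> \<beta>" if r: "r \<ge> 0" "KE * (r * norm (\<Phi> u)) \<le> 1" for r
      proof -
        define w where "w = tangent_of AX x c (r *\<^sub>R u)"
        define e where "e = Q (F x) (F' x w)"
        have w: "w \<in> tangent_space AX x" "w c = r *\<^sub>R u"
          using tangent_of_in_tangent_space[OF AX c(1) x] tangent_of_self[OF AX c(1) x]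
          by (simp_all add: w_def)
        have pe: "p e = p (F x)" using Q_p[OF w(1)] by (simp add: e_def)
        have "p e \<in> UE" using \<xi>(2) x\<xi> pe by (simp add: \<pi>_def)
        then have "NE e \<le> KE * norm (snd s e)" by (rule UE(4))
        also have "norm (snd s e) = r * norm (\<Phi> u)"
          using Q_s[OF w(1)] w(2) r(1) by (simp add: e_def \<Phi>_scale)
        finally have "NE e \<le> 1" using r(2) by linarith
        then have "e \<in> {e \<in> p -` {p (F x)}. NE e \<le> 1}" using pe by simp
        then have "ereal (NX (x, inv_into (tangent_space AX x) (\<lambda>v. Q (F x) (F' x v)) e)) \<le> ereal \<beta>"
          by (rule order_trans[OF SUP_upper inv[of x, unfolded operator_norm_def]])
        moreover have "inv_into (tangent_space AX x) (\<lambda>v. Q (F x) (F' x v)) e = w"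
          unfolding e_def by (rule inv_into_f_f[OF bij_betw_imp_inj_on[OF bij] w(1)])
        ultimately have "NX (x, w) \<le> \<beta>" by simp
        then show ?thesis using UX(4)[OF xUX w(1)] w(2) r(1) by simp
      qed
      from bound_from_scaling[OF UE(3) UX(3) norm_ge_zero norm_ge_zero this]
      have "norm u \<le> \<bar>\<beta>\<bar> * KE / m * norm (\<Phi> u)" .
      also have "\<dots> \<le> C * norm (\<Phi> u)" by (intro mult_right_mono) (simp_all add: C_def)
      finally show ?thesis .
    qed
    have "\<Phi> (v c) + snd s (F x) = 0"
    proof -
      have pq: "p (Q (F x) (F' x v)) \<in> fst s" using Q_p[OF v] xs by simp
      show ?thesis
        using fibre_add_triv(2)[OF E AY s(1) pq Q_p[OF v, symmetric]] step Q_s[OF v]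
          fibre_zero_triv(2)[OF E AY s(1)] xs by simp
    qed
    \<comment> \<open>The Newton equation replaces \<open>\<Phi> (v c)\<close> by
      \<open>- snd s (F x)\<close>. Since the fibre part of \<open>F z\<close> is 0, the sum with
      \<open>\<Phi> h\<close> is the fibre part of the Newton remainder minus the connection term at
      \<open>T h\<close>.\<close>
    then have "\<Phi> (v c + h) = \<Phi> h - snd s (F x)" by (simp add: \<Phi>_add eq_neg_iff_add_eq_0)
    also have "\<dots> = snd (T h - (f \<xi> - f (snd c z))) - blinfun_apply (b \<xi>) (fst (T h))"
      using f_app[OF x] fz by (simp add: \<Phi>_def \<xi>_def)
    also have "norm \<dots> \<le> norm (T h - (f \<xi> - f (snd c z))) + norm (b \<xi>) * norm (T h)"
    proof -
      have "norm (blinfun_apply (b \<xi>) (fst (T h))) \<le> norm (b \<xi>) * norm (fst (T h))" by (rule norm_blinfun)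
      also have "\<dots> \<le> norm (b \<xi>) * norm (T h)"
        by (intro mult_left_mono) (use norm_fst_le[of "fst (T h)" "snd (T h)"] in auto)
      finally have "norm (blinfun_apply (b \<xi>) (fst (T h))) \<le> norm (b \<xi>) * norm (T h)" .
      moreover have "norm (snd u) \<le> norm u" for u :: "'b \<times> 'v"
        using norm_snd_le[of "snd u" "fst u"] by simp
      note this[of "T h - (f \<xi> - f (snd c z))"]
        norm_triangle_ineq4[of "snd (T h - (f \<xi> - f (snd c z)))" "blinfun_apply (b \<xi>) (fst (T h))"]
      ultimately show ?thesis by linarith
    qed
    also have "\<dots> \<le> \<epsilon>2 * norm h + \<epsilon>1 * (K * norm h)"
    proof (rule add_mono)
      \<comment> \<open>The limit of the difference quotient says nothing at the centre itself,
        where both sides are 0.\<close>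
      show "norm (T h - (f \<xi> - f (snd c z))) \<le> \<epsilon>2 * norm h"
      proof (cases "\<xi> = snd c z")
        case True
        then show ?thesis by (simp add: h_def linear_0[OF bounded_linear.linear[OF T]])
      next
        case False
        then show ?thesis using Newton[of \<xi>] small by (simp add: h_def T_def \<xi>_def)
      qed
      have "norm (T h) \<le> onorm T * norm h" by (rule onorm[OF T])
      also have "\<dots> \<le> K * norm h"
        using K0 \<xi>(5) K(2) by (intro mult_right_mono) (auto simp: T_def)
      finally show "norm (b \<xi>) * norm (T h) \<le> \<epsilon>1 * (K * norm h)"
        using \<xi>(3) eps(1) by (intro mult_mono) auto
    qed
    finally have "norm (\<Phi> (v c + h)) \<le> (\<epsilon>2 + \<epsilon>1 * K) * norm h" by (simp add: algebra_simps)
    then have "C * norm (\<Phi> (v c + h)) \<le> C * ((\<epsilon>2 + \<epsilon>1 * K) * norm h)" using C by simp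
    then have "norm (v c + h) \<le> C * (\<epsilon>2 + \<epsilon>1 * K) * norm h"
      using inverse_bound[of "v c + h"] by (simp add: mult.assoc)
    then show "norm (v c + (snd c x - snd c z)) \<le> \<epsilon> * norm (snd c x - snd c z)"
      unfolding eps(3) h_def \<xi>_def .
  qed
qed

text \<open>The step is the negative of the error up to lower order, and the retraction adds it to
  the error up to lower order. Of the Newton equation only the first of these facts is used, hence
  the abstract predicate \<open>step\<close>.\<close>

lemma newton_step_superlinear:
  fixes AX :: "('x::t2_space, 'a::real_normed_vector) chart set"
    and step :: "'x \<Rightarrow> ('x, 'a) tvec \<Rightarrow> bool"
  assumes c: "c \<in> AX" "z \<in> fst c"
    and R: "\<And>\<epsilon>. \<epsilon> > 0 \<Longrightarrow> \<exists>\<eta>>0. \<forall>x\<in>fst c. \<forall>v\<in>tangent_space AX x.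
      norm (snd c x - snd c z) < \<eta> \<longrightarrow> norm (v c) < \<eta> \<longrightarrow> R x v \<in> fst c \<and>
      norm (snd c (R x v) - snd c z - (snd c x - snd c z + v c))
        \<le> \<epsilon> * (norm (snd c x - snd c z) + norm (v c))"
    and N: "\<And>\<epsilon>. \<epsilon> > 0 \<Longrightarrow> \<exists>\<eta>>0. \<forall>x\<in>fst c. \<forall>v\<in>tangent_space AX x.
      norm (snd c x - snd c z) < \<eta> \<longrightarrow> step x v \<longrightarrow>
      norm (v c + (snd c x - snd c z)) \<le> \<epsilon> * norm (snd c x - snd c z)"
    and \<epsilon>: "\<epsilon> > 0"
  shows "\<exists>\<eta>>0. \<forall>x\<in>fst c. \<forall>v\<in>tangent_space AX x.
    norm (snd c x - snd c z) < \<eta> \<longrightarrow> step x v \<longrightarrow>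
    R x v \<in> fst c \<and> norm (snd c (R x v) - snd c z) \<le> \<epsilon> * norm (snd c x - snd c z)"
proof -
  \<comment> \<open>The retraction contributes at most three quarters of
    \<open>\<epsilon> * norm h\<close>, because \<open>norm h + norm (v c)\<close> is at most
    \<open>3 * norm h\<close>, and the Newton step contributes the last quarter.\<close>
  have quarter: "\<epsilon> / 4 > 0" using \<epsilon> by simp
  obtain \<eta>1 where \<eta>1: "\<eta>1 > 0" "\<forall>x\<in>fst c. \<forall>v\<in>tangent_space AX x.
      norm (snd c x - snd c z) < \<eta>1 \<longrightarrow> norm (v c) < \<eta>1 \<longrightarrow> R x v \<in> fst c \<and>
      norm (snd c (R x v) - snd c z - (snd c x - snd c z + v c))
        \<le> \<epsilon> / 4 * (norm (snd c x - snd c z) + norm (v c))"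
    using R[OF quarter] by (elim exE conjE)
  \<comment> \<open>The cap at 1 gives \<open>norm (v c) \<le> 2 * norm h\<close>; together with the
    radius \<open>\<eta>1 / 2\<close> for \<open>h\<close> it keeps the step within \<eta>1.\<close>
  define \<epsilon>0 where "\<epsilon>0 = min 1 (\<epsilon> / 4)"
  have \<epsilon>0: "\<epsilon>0 > 0" "\<epsilon>0 \<le> 1" "\<epsilon>0 \<le> \<epsilon> / 4" using \<epsilon> by (simp_all add: \<epsilon>0_def)
  obtain \<eta>2 where \<eta>2: "\<eta>2 > 0" "\<forall>x\<in>fst c. \<forall>v\<in>tangent_space AX x.
      norm (snd c x - snd c z) < \<eta>2 \<longrightarrow> step x v \<longrightarrow>
      norm (v c + (snd c x - snd c z)) \<le> \<epsilon>0 * norm (snd c x - snd c z)"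
    using N[OF \<epsilon>0(1)] by (elim exE conjE)
  show ?thesis
  proof (intro exI[of _ "min (\<eta>1 / 2) \<eta>2"] ballI conjI impI)
    show "0 < min (\<eta>1 / 2) \<eta>2" using \<eta>1(1) \<eta>2(1) by simp
    fix x v assume x: "x \<in> fst c" and v: "v \<in> tangent_space AX x"
      and small: "norm (snd c x - snd c z) < min (\<eta>1 / 2) \<eta>2" and st: "step x v"
    define h where "h = snd c x - snd c z"
    have h: "norm h < \<eta>1 / 2" "norm h < \<eta>2" using small by (simp_all add: h_def)
    have vh: "norm (v c + h) \<le> \<epsilon>0 * norm h"
      using bspec[OF bspec[OF \<eta>2(2) x] v] h st by (simp add: h_def)
    have "\<epsilon>0 * norm h \<le> 1 * norm h" using \<epsilon>0 by (intro mult_right_mono) auto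
    moreover have "norm (v c) \<le> norm (v c + h) + norm h"
      using norm_triangle_ineq4[of "v c + h" h] by simp
    ultimately have vc: "norm (v c) \<le> 2 * norm h" using vh by linarith
    then have vs: "norm (v c) < \<eta>1" "norm h < \<eta>1" using h \<eta>1(1) by linarith+
    have r: "R x v \<in> fst c \<and> norm (snd c (R x v) - snd c z - (h + v c)) \<le> \<epsilon> / 4 * (norm h + norm (v c))"
      using bspec[OF bspec[OF \<eta>1(2) x] v] vs by (simp add: h_def)
    then show "R x v \<in> fst c" by simp
    have "norm (snd c (R x v) - snd c z)
        \<le> norm (snd c (R x v) - snd c z - (h + v c)) + norm (v c + h)"
      using norm_triangle_ineq[of "snd c (R x v) - snd c z - (h + v c)" "h + v c"]
      by (simp add: add.commute)
    also have "\<dots> \<le> \<epsilon> / 4 * (norm h + norm (v c)) + \<epsilon>0 * norm h"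
      using r vh by (intro add_mono) auto
    also have "\<dots> \<le> \<epsilon> / 4 * (norm h + 2 * norm h) + \<epsilon> / 4 * norm h"
      using vc \<epsilon> \<epsilon>0(3) by (intro add_mono mult_left_mono mult_right_mono) auto
    also have "\<dots> = \<epsilon> * norm h" by (simp add: algebra_simps)
    finally show "norm (snd c (R x v) - snd c z) \<le> \<epsilon> * norm (snd c x - snd c z)"
      by (simp add: h_def)
  qed
qed

section \<open>Local superlinear convergence of the Newton iterates\<close>

theorem proposition5p11:
  fixes AX :: "('x::t2_space, 'a::banach) chart set"
    and AY :: "('y::topological_space, 'b::banach) chart set"
    and p :: "'e::topological_space \<Rightarrow> 'y"
    and TR :: "('y, 'e, 'v::banach) triv set"
    and NX :: "'x \<times> ('x, 'a) tvec \<Rightarrow> real"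
    and NE :: "'e \<Rightarrow> real"
    and Q :: "'e \<Rightarrow> ('e, 'b \<times> 'v) tvec \<Rightarrow> 'e"
    and R :: "'x \<Rightarrow> ('x, 'a) tvec \<Rightarrow> 'x"
    and F :: "'x \<Rightarrow> 'e"
    and F' :: "'x \<Rightarrow> ('x, 'a) tvec \<Rightarrow> ('e, 'b \<times> 'v) tvec"
    and xs :: 'x
    and \<beta> :: real
  assumes "C1_manifold AX" and "connected (UNIV :: 'x set)"
    and "C1_manifold AY" and "C1_vector_bundle AY p TR"
    and "continuous_norm (tangent_bundle AX) fst (tangent_trivs AX) NX"
    and "continuous_norm UNIV p TR NE"
    and "linear_continuous_connection_map AY p TR Q"
    and "C1_retraction AX R"
    and "locally_lipschitz_in_charts AX (total_atlas AY p TR) F"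
    and "hom_section AX (total_atlas AY p TR) F F'"
    and "locally_bounded_in_charts AX (total_atlas AY p TR) F F'"
    and "newton_differentiable_at AX (total_atlas AY p TR) F F' xs"
    and "F xs = fibre_zero p TR (p (F xs))"
    and "\<And>x. bij_betw (\<lambda>v. Q (F x) (F' x v)) (tangent_space AX x) (p -` {p (F x)})"
    and "\<And>x. operator_norm (p -` {p (F x)}) NE (\<lambda>v. NX (x, v))
               (inv_into (tangent_space AX x) (\<lambda>v. Q (F x) (F' x v))) \<le> ereal \<beta>"
  shows "\<exists>W. open W \<and> xs \<in> W \<and> (\<forall>x\<^sub>0\<in>W.
           (\<exists>x. newton_sequence AX p TR Q R F F' x \<and> x 0 = x\<^sub>0) \<and>
           (\<forall>x. newton_sequence AX p TR Q R F F' x \<and> x 0 = x\<^sub>0 \<longrightarrow>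
              x \<longlonglongrightarrow> xs \<and>
              ((\<exists>k. x k = xs) \<or>
               (\<lambda>k. manifold_dist AX NX (x (Suc k)) xs / manifold_dist AX NX (x k) xs)
                 \<longlonglongrightarrow> 0)))"
proof -
  have AX: "C1_atlas AX" and AY: "C1_atlas AY"
    using assms(1,3) unfolding C1_manifold_def by auto
  note E = assms(4) and NX = assms(5) and NE = assms(6) and Q = assms(7) and R = assms(8)
  define step where "step x v \<longleftrightarrow>
    fibre_add p TR (Q (F x) (F' x v)) (F x) = fibre_zero p TR (p (F x))" for x v
  obtain c where c: "c \<in> AX" "xs \<in> fst c"
    and retr: "\<And>\<epsilon>. \<epsilon> > 0 \<Longrightarrow> \<exists>\<eta>>0. \<forall>x\<in>fst c. \<forall>v\<in>tangent_space AX x.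
      norm (snd c x - snd c xs) < \<eta> \<longrightarrow> norm (v c) < \<eta> \<longrightarrow> R x v \<in> fst c \<and>
      norm (snd c (R x v) - snd c xs - (snd c x - snd c xs + v c))
        \<le> \<epsilon> * (norm (snd c x - snd c xs) + norm (v c))"
    by (rule retraction_chart_expansion[OF AX R, of xs]) (rule that)
  have ch: "is_chart c" using AX c(1) by (rule C1_atlas_is_chart)
  have superlinear: "\<exists>\<eta>>0. \<forall>x\<in>fst c. \<forall>v\<in>tangent_space AX x.
      norm (snd c x - snd c xs) < \<eta> \<longrightarrow> step x v \<longrightarrow>
      R x v \<in> fst c \<and> norm (snd c (R x v) - snd c xs) \<le> \<epsilon> * norm (snd c x - snd c xs)"
    if "\<epsilon> > 0" for \<epsilon>
    unfolding step_def
    by (rule newton_step_superlinear[OF c retr newton_step_estimate[OF AX AY E NX NE Q assms(9-15) c] that])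
  obtain r m M where dist: "r > 0" "m > 0" "M > 0"
    "\<And>x. x \<in> fst c \<Longrightarrow> norm (snd c x - snd c xs) < r \<Longrightarrow>
      m * norm (snd c x - snd c xs) \<le> manifold_dist AX NX x xs"
    "\<And>x. x \<in> fst c \<Longrightarrow> norm (snd c x - snd c xs) < r \<Longrightarrow>
      manifold_dist AX NX x xs \<le> M * norm (snd c x - snd c xs)"
    by (rule manifold_dist_locally_equivalent[OF AX NX c]) (rule that)
  \<comment> \<open>With the factor 1/2 the iterates stay in the chart ball of radius \<eta> and the
    errors decay geometrically. The superlinear rate is obtained afterwards from smaller factors,
    valid for late iterates.\<close>
  have half: "(1/2 :: real) > 0" by simp
  obtain \<eta> where \<eta>: "\<eta> > 0" "\<forall>x\<in>fst c. \<forall>v\<in>tangent_space AX x.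
      norm (snd c x - snd c xs) < \<eta> \<longrightarrow> step x v \<longrightarrow>
      R x v \<in> fst c \<and> norm (snd c (R x v) - snd c xs) \<le> 1/2 * norm (snd c x - snd c xs)"
    using superlinear[OF half] by (elim exE conjE)
  define W where "W = fst c \<inter> snd c -` ball (snd c xs) \<eta>"
  have "open W" unfolding W_def by (rule is_chart_vimage_open[OF ch open_ball])
  moreover have "xs \<in> W" using c(2) \<eta>(1) by (simp add: W_def)
  moreover have "\<exists>x. newton_sequence AX p TR Q R F F' x \<and> x 0 = x\<^sub>0" for x\<^sub>0
  proof -
    \<comment> \<open>The operator is invertible at every point, so a choice of steps on the whole
      manifold defines an iteration from any start.\<close>
    have "\<exists>v. v \<in> tangent_space AX x \<and> step x v" for x
    proof -
      obtain v where "v \<in> tangent_space AX x"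
        "fibre_add p TR (Q (F x) (F' x v)) (F x) = fibre_zero p TR (p (F x))"
        by (rule newton_step_exists[OF E AY assms(14)])
      then show ?thesis unfolding step_def by blast
    qed
    then obtain \<delta> where \<delta>: "\<And>x. \<delta> x \<in> tangent_space AX x \<and> step x (\<delta> x)"
      using choice[of "\<lambda>x v. v \<in> tangent_space AX x \<and> step x v"] by blast
    define x where "x k = ((\<lambda>y. R y (\<delta> y)) ^^ k) x\<^sub>0" for k
    have "newton_sequence AX p TR Q R F F' x"
      unfolding newton_sequence_def step_def[symmetric]
      using \<delta> by (auto simp: x_def intro!: bexI[of _ "\<delta> _"])
    then show ?thesis by (intro exI[of _ x]) (simp add: x_def)
  qed
  moreover have "x \<longlonglongrightarrow> xs \<and> ((\<exists>k. x k = xs) \<or>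
      (\<lambda>k. manifold_dist AX NX (x (Suc k)) xs / manifold_dist AX NX (x k) xs) \<longlonglongrightarrow> 0)"
    if x0: "x 0 \<in> W" and seq: "newton_sequence AX p TR Q R F F' x" for x
  proof -
    define h where "h k = norm (snd c (x k) - snd c xs)" for k
    have "\<forall>k. \<exists>v\<in>tangent_space AX (x k). step (x k) v \<and> x (Suc k) = R (x k) v"
      using seq unfolding newton_sequence_def step_def .
    then obtain v where v: "\<And>k. v k \<in> tangent_space AX (x k)" "\<And>k. step (x k) (v k)"
      "\<And>k. x (Suc k) = R (x k) (v k)"
      by metis
    have inv: "x k \<in> fst c \<and> h k \<le> (1/2) ^ k * h 0" for k
    proof (induction k)
      case 0
      then show ?case using x0 by (simp add: W_def)
    next
      case (Suc k)
      have "h 0 < \<eta>" using x0 by (simp add: W_def h_def dist_norm norm_minus_commute)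
      moreover have "(1/2) ^ k * h 0 \<le> 1 * h 0"
        by (intro mult_right_mono power_le_one) (simp_all add: h_def)
      ultimately have "h k < \<eta>" using Suc by linarith
      then have "x (Suc k) \<in> fst c \<and> h (Suc k) \<le> 1/2 * h k"
        using \<eta>(2) Suc v[of k] by (simp add: h_def)
      then show ?case using Suc by auto
    qed
    have mem: "x k \<in> fst c" for k using inv by blast
    have "(\<lambda>k. (1/2) ^ k * h 0) \<longlonglongrightarrow> 0 * h 0"
      by (intro tendsto_mult_right LIMSEQ_power_zero) simp
    then have h_lim: "h \<longlonglongrightarrow> 0"
      by (intro tendsto_sandwich[of "\<lambda>_. 0" h sequentially "\<lambda>k. (1/2) ^ k * h 0"])
         (use inv in \<open>auto simp: h_def\<close>)
    then have "(\<lambda>k. snd c (x k) - snd c xs) \<longlonglongrightarrow> 0"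
      unfolding h_def[abs_def] by (rule tendsto_norm_zero_cancel)
    then have "(\<lambda>k. snd c (x k)) \<longlonglongrightarrow> snd c xs" by (rule LIM_zero_cancel)
    then have "(\<lambda>k. chart_inv c (snd c (x k))) \<longlonglongrightarrow> chart_inv c (snd c xs)"
      by (rule continuous_on_tendsto_compose[OF is_chart_inv_continuous[OF ch]])
         (use mem c(2) in simp_all)
    then have "x \<longlonglongrightarrow> xs" using mem c(2) ch by simp
    moreover have "(\<lambda>k. manifold_dist AX NX (x (Suc k)) xs / manifold_dist AX NX (x k) xs) \<longlonglongrightarrow> 0"
      if ne: "\<nexists>k. x k = xs"
    proof (rule tendstoI)
      fix e :: real assume "e > 0"
      \<comment> \<open>The quotient of distances is at most \<open>M * \<epsilon> / m\<close>,
        which is \<open>e / 2\<close> for this choice.\<close>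
      define \<epsilon> where "\<epsilon> = e * m / (2 * M)"
      have "\<epsilon> > 0" using \<open>e > 0\<close> dist(2,3) by (simp add: \<epsilon>_def)
      from superlinear[OF this] obtain \<eta>' where \<eta>': "\<eta>' > 0" "\<forall>x\<in>fst c. \<forall>v\<in>tangent_space AX x.
          norm (snd c x - snd c xs) < \<eta>' \<longrightarrow> step x v \<longrightarrow>
          R x v \<in> fst c \<and> norm (snd c (R x v) - snd c xs) \<le> \<epsilon> * norm (snd c x - snd c xs)"
        by (elim exE conjE)
      have ev: "\<forall>\<^sub>F k in sequentially. h k < min r \<eta>'"
        by (rule order_tendstoD(2)[OF h_lim]) (use dist(1) \<eta>'(1) in simp)
      \<comment> \<open>The numerator involves the next iterate, which must also lie where the
        metric is comparable with the chart norm.\<close>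
      then have "\<forall>\<^sub>F k in sequentially. h (Suc k) < min r \<eta>'"
        by (rule eventually_sequentially_Suc[THEN iffD2])
      with ev show "\<forall>\<^sub>F k in sequentially.
        dist (manifold_dist AX NX (x (Suc k)) xs / manifold_dist AX NX (x k) xs) 0 < e"
      proof eventually_elim
        case (elim k)
        have "x k \<noteq> xs" using ne by blast
        then have hk: "h k > 0" using chart_eqD[OF ch mem c(2)] by (auto simp: h_def)
        have step: "h (Suc k) \<le> \<epsilon> * h k" using \<eta>'(2) elim mem v[of k] by (simp add: h_def)
        have lo: "m * h k \<le> manifold_dist AX NX (x k) xs"
          using dist(4)[OF mem, of k] elim by (simp add: h_def)
        have up: "manifold_dist AX NX (x (Suc k)) xs \<le> M * h (Suc k)"
          and pos: "0 \<le> manifold_dist AX NX (x (Suc k)) xs"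
          using dist(4)[OF mem, of "Suc k"] dist(5)[OF mem, of "Suc k"] elim dist(2)
          by (auto simp: h_def intro: order_trans[rotated])
        have mh: "0 < m * h k" using dist(2) hk by simp
        have "manifold_dist AX NX (x (Suc k)) xs / manifold_dist AX NX (x k) xs \<le> M * (\<epsilon> * h k) / (m * h k)"
        proof (rule frac_le)
          show "manifold_dist AX NX (x (Suc k)) xs \<le> M * (\<epsilon> * h k)"
            using up mult_left_mono[OF step, of M] dist(3) by linarith
        qed (use lo mh \<open>\<epsilon> > 0\<close> dist(3) hk in auto)
        also have "\<dots> = e / 2" using hk dist(2,3) by (simp add: \<epsilon>_def)
        also have "\<dots> < e" using \<open>e > 0\<close> by simp
        finally show ?case using pos lo mh by (simp add: dist_real_def)
      qed
    qed
    ultimately show ?thesis by blast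
  qed
  ultimately show ?thesis by blast
qed

end
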